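(* Let $k\ge 1$, let $F(z_1,\dots,z_k)$ be a nonzero Laurent polynomial with integer coefficients, and suppose that $0\in\mathcal M(F)$. Then $0$ is an isolated point of $\mathcal M(F)$.
   Context: For a nonzero complex Laurent polynomial $G$ in $\ell\ge 0$ variables, its (logarithmic) Mahler measure is $$m(G)=\int_0^1\cdots\int_0^1\log|G(e^{2\pi i t_1},\dots,e^{2\pi i t_\ell})|\,dt_1\cdots dt_\ell,$$ so $m(G)=\log|G|$ when $\ell=0$ ($G$ a nonzero constant). For $\ell\ge 0$ and $A=(a_{ij})\in\mathbb Z^{\ell\times k}$, put $$(z_1,\dots,z_\ell)^A=(z_1^{a_{11}}\cdots z_\ell^{a_{\ell 1}},\ \dots,\ z_1^{a_{1k}}\cdots z_\ell^{a_{\ell k}}),$$ a $k$-tuple of monomials (equal to $(1,\dots,1)$ when $\ell=0$), and define $F_A(z_1,\dots,z_\ell)=F((z_1,\dots,z_\ell)^A)$. Define $$\mathcal M(F)=\{m(F_A) : A\in\mathbb Z^{\ell\times k},\ \ell\ge 0,\ F_A\neq 0\}\subseteq\mathbb R.$$ *)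

theory Defs
  imports "HOL-Analysis.Analysis" "HOL-Library.Poly_Mapping"
begin

text \<open>Laurent polynomials are finitely supported functions from exponent vectors to coefficients,
  where an exponent vector is a finitely supported function from variable indices to the integers.
  With the convolution product of \<^theory>\<open>HOL-Library.Poly_Mapping\<close> this type is the Laurent
  polynomial ring in countably many variables; \<open>laurent_polys n\<close> is its subring in the variables
  with indices \<open>0, \<dots>, n - 1\<close>.\<close>

type_synonym 'a laurent = "(nat \<Rightarrow>\<^sub>0 int) \<Rightarrow>\<^sub>0 'a"

definition laurent_polys :: "nat \<Rightarrow> ('a::zero) laurent set" where
  "laurent_polys n = {G. \<forall>e\<in>Poly_Mapping.keys G. Poly_Mapping.keys e \<subseteq> {..<n}}"

definition laurent_eval :: "complex laurent \<Rightarrow> (nat \<Rightarrow> complex) \<Rightarrow> complex" where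
  "laurent_eval G z =
     (\<Sum>e\<in>Poly_Mapping.keys G. Poly_Mapping.lookup G e *
        (\<Prod>i\<in>Poly_Mapping.keys e. z i powi Poly_Mapping.lookup e i))"

text \<open>For \<open>l = 0\<close> the product measure is the unit point mass, so the value is the logarithm of the
  absolute value of the constant. For nonzero \<open>G\<close> the zero set on the torus is a null set, so the
  convention \<open>ln 0 = 0\<close> does not affect the integral.\<close>

definition mahler_measure :: "nat \<Rightarrow> complex laurent \<Rightarrow> real" where
  "mahler_measure l G =
     (LINT t : (\<Pi>\<^sub>E i\<in>{..<l}. {0..1}) | (\<Pi>\<^sub>M i\<in>{..<l}. lborel).
        ln (cmod (laurent_eval G (\<lambda>i. exp (2 * of_real pi * \<i> * of_real (t i))))))"

text \<open>An \<open>l \<times> k\<close> integer matrix is a function \<open>A\<close> of which only the entries \<open>A i j\<close> with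
  \<open>i < l\<close> and \<open>j < k\<close> are used. Substituting the monomials \<open>z\<^sup>A\<close> turns the monomial with exponent
  vector \<open>e\<close> into the one with exponent vector \<open>A e\<close>; distinct monomials may be merged or
  cancel. See \<open>laurent_eval_monomial_subst\<close> below.\<close>

definition exponent_map ::
  "nat \<Rightarrow> nat \<Rightarrow> (nat \<Rightarrow> nat \<Rightarrow> int) \<Rightarrow> (nat \<Rightarrow>\<^sub>0 int) \<Rightarrow> (nat \<Rightarrow>\<^sub>0 int)" where
  "exponent_map l k A e =
     (\<Sum>i<l. Poly_Mapping.single i (\<Sum>j<k. A i j * Poly_Mapping.lookup e j))"

definition monomial_subst ::
  "nat \<Rightarrow> nat \<Rightarrow> (nat \<Rightarrow> nat \<Rightarrow> int) \<Rightarrow> complex laurent \<Rightarrow> complex laurent" where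
  "monomial_subst l k A F =
     (\<Sum>e\<in>Poly_Mapping.keys F.
        Poly_Mapping.single (exponent_map l k A e) (Poly_Mapping.lookup F e))"

definition mahler_set :: "nat \<Rightarrow> complex laurent \<Rightarrow> real set" where
  "mahler_set k F =
     {mahler_measure l (monomial_subst l k A F) | l A. monomial_subst l k A F \<noteq> 0}"

lemma lookup_exponent_map:
  "Poly_Mapping.lookup (exponent_map l k A e) i =
     (if i < l then \<Sum>j<k. A i j * Poly_Mapping.lookup e j else 0)"
proof -
  have "Poly_Mapping.lookup (exponent_map l k A e) i =
      (\<Sum>i'<l. if i' = i then (\<Sum>j<k. A i' j * Poly_Mapping.lookup e j) else 0)"
    by (simp add: exponent_map_def lookup_sum lookup_single when_def)
  then show ?thesis
    by simp
qed

lemma keys_exponent_map: "Poly_Mapping.keys (exponent_map l k A e) \<subseteq> {..<l}"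
  by (auto simp: in_keys_iff lookup_exponent_map split: if_splits)

lemma monomial_subst_in_laurent_polys: "monomial_subst l k A F \<in> laurent_polys l"
proof -
  have "Poly_Mapping.keys (monomial_subst l k A F) \<subseteq> range (exponent_map l k A)"
    unfolding monomial_subst_def
    by (rule order_trans[OF keys_sum]) auto
  then show ?thesis
    using keys_exponent_map by (fastforce simp: laurent_polys_def)
qed

lemma laurent_eval_superset:
  assumes "finite S" "Poly_Mapping.keys G \<subseteq> S"
  shows "laurent_eval G z = (\<Sum>e\<in>S. Poly_Mapping.lookup G e *
           (\<Prod>i\<in>Poly_Mapping.keys e. z i powi Poly_Mapping.lookup e i))"
  unfolding laurent_eval_def
  by (rule sum.mono_neutral_left) (use assms in \<open>auto simp: in_keys_iff\<close>)

lemma laurent_eval_add: "laurent_eval (G + H) z = laurent_eval G z + laurent_eval H z"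
proof -
  let ?S = "Poly_Mapping.keys G \<union> Poly_Mapping.keys H"
  have "Poly_Mapping.keys (G + H) \<subseteq> ?S"
    by (rule Poly_Mapping.keys_add)
  then show ?thesis
    by (simp add: laurent_eval_superset[of ?S] lookup_add distrib_right sum.distrib)
qed

lemma laurent_eval_sum: "laurent_eval (\<Sum>x\<in>X. g x) z = (\<Sum>x\<in>X. laurent_eval (g x) z)"
  by (induction X rule: infinite_finite_induct)
     (simp_all add: laurent_eval_add, simp_all add: laurent_eval_def)

lemma laurent_eval_single:
  "laurent_eval (Poly_Mapping.single e c) z =
     c * (\<Prod>i\<in>Poly_Mapping.keys e. z i powi Poly_Mapping.lookup e i)"
  by (subst laurent_eval_superset[of "{e}"]) auto

lemma prod_powi_superset:
  fixes z :: "nat \<Rightarrow> complex"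
  assumes "Poly_Mapping.keys e \<subseteq> {..<n}"
  shows "(\<Prod>i\<in>Poly_Mapping.keys e. z i powi Poly_Mapping.lookup e i) =
    (\<Prod>i<n. z i powi Poly_Mapping.lookup e i)"
  by (rule prod.mono_neutral_left) (use assms in \<open>auto simp: in_keys_iff\<close>)

lemma powi_sum:
  fixes x :: complex
  assumes "x \<noteq> 0"
  shows "x powi (\<Sum>j\<in>J. f j) = (\<Prod>j\<in>J. x powi f j)"
  by (induction J rule: infinite_finite_induct) (use assms in \<open>simp_all add: power_int_add\<close>)

lemma prod_powi:
  fixes f :: "nat \<Rightarrow> complex"
  shows "(\<Prod>i\<in>I. f i) powi n = (\<Prod>i\<in>I. f i powi n)"
  by (induction I rule: infinite_finite_induct) (simp_all add: power_int_mult_distrib)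

lemma laurent_eval_monomial_subst:
  assumes F: "F \<in> laurent_polys k" and z: "\<And>i. i < l \<Longrightarrow> z i \<noteq> 0"
  shows "laurent_eval (monomial_subst l k A F) z =
    laurent_eval F (\<lambda>j. \<Prod>i<l. z i powi A i j)"
proof -
  have "(\<Prod>i\<in>Poly_Mapping.keys (exponent_map l k A e).
            z i powi Poly_Mapping.lookup (exponent_map l k A e) i) =
        (\<Prod>j\<in>Poly_Mapping.keys e. (\<Prod>i<l. z i powi A i j) powi Poly_Mapping.lookup e j)"
    if "e \<in> Poly_Mapping.keys F" for e
  proof -
    have e: "Poly_Mapping.keys e \<subseteq> {..<k}"
      using F that by (auto simp: laurent_polys_def)
    have "(\<Prod>i<l. z i powi Poly_Mapping.lookup (exponent_map l k A e) i) =
        (\<Prod>i<l. \<Prod>j<k. (z i powi A i j) powi Poly_Mapping.lookup e j)"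
      by (intro prod.cong) (simp_all add: lookup_exponent_map powi_sum z power_int_mult)
    also have "\<dots> = (\<Prod>j<k. \<Prod>i<l. (z i powi A i j) powi Poly_Mapping.lookup e j)"
      by (rule prod.swap)
    finally show ?thesis
      by (simp only: prod_powi_superset[OF e] prod_powi_superset[OF keys_exponent_map])
         (simp only: prod_powi)
  qed
  then show ?thesis
    by (simp add: monomial_subst_def laurent_eval_sum laurent_eval_single)
       (simp add: laurent_eval_def)
qed

lemma mahler_measure_0: "mahler_measure 0 G = ln (cmod (laurent_eval G (\<lambda>_. 1)))"
  if "G \<in> laurent_polys 0" for G
proof -
  have "Poly_Mapping.keys e = {}" if "e \<in> Poly_Mapping.keys G" for e
    using \<open>G \<in> laurent_polys 0\<close> that by (auto simp: laurent_polys_def)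
  then have *: "laurent_eval G z = laurent_eval G w" for z w
    unfolding laurent_eval_def
    by (intro sum.cong arg_cong2[where f = "(*)"] refl) (simp del: keys_eq_empty)
  show ?thesis
    unfolding mahler_measure_def set_lebesgue_integral_def
    by (simp add: PiM_empty lebesgue_integral_count_space_finite)
       (rule arg_cong[where f = "\<lambda>x. ln (cmod x)"], rule *)
qed

end

theory Submission
  imports Defs "HOL-Probability.Probability" "HOL-Computational_Algebra.Fundamental_Theorem_Algebra"
begin

text \<open>Suppose there were matrices \<open>A\<close> with \<open>m(F\<^sub>A)\<close> positive and arbitrarily small. By a maximality
  argument there is a set \<open>\<Lambda>\<close> of exponent vectors that lies in the kernel of such matrices and is
  all of their kernel within any prescribed finite set. Fix one such matrix \<open>A\<close>, and let \<open>A'\<close> be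
  another one with \<open>m(F\<^bsub>A'\<^esub>)\<close> much smaller and with no accidental relations outside \<open>\<Lambda>\<close> up
  to a large height. Consider \<open>W(y, x) = F(y\<^bsup>A'\<^esup> x\<^bsup>A\<^esup>)\<close> on the product of the two tori.
  Only the relations in \<open>\<Lambda>\<close> matter when \<open>ln \<bar>F\<bar>\<close> is replaced by a trigonometric approximation,
  so for every \<open>x\<close> the mean of \<open>ln \<bar>W\<bar>\<close> over \<open>y\<close> is close to \<open>m(F\<^bsub>A'\<^esub>)\<close>. On the other hand, for
  fixed \<open>y\<close> the polynomial \<open>W(y, -)\<close> has the coefficients of \<open>F\<^sub>A\<close> up to unimodular factors, so its
  Mahler measure is nonnegative, and it is close to \<open>m(F\<^sub>A) > 0\<close> when \<open>y\<^bsup>A'\<^esup>\<close> is close to \<open>1\<close>. By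
  the pigeonhole principle this happens with a probability bounded below independently of \<open>A'\<close>, a
  contradiction. The singularities of the logarithm are controlled uniformly by a bound for the
  measure of the set where \<open>\<bar>f\<bar> < y\<close> that depends only on the number of terms of \<open>f\<close>.\<close>

subsection \<open>Haar measure on the torus\<close>

text \<open>The matrices are unbounded in size and in entries, so an estimate may use only what
  every substitution preserves: the number of terms does not grow, and integrality keeps nonzero
  coefficients at modulus at least 1. Both facts survive a unimodular twist, although the twisted
  coefficients are no longer integers; hence the analytic lemmas ask for no more than this. The
  order of choices is the delicate point. A first truncation height \<open>\<eta>0\<close> serves
  the lower bound for fixed \<open>y\<close> and fixes the closeness \<open>\<rho>\<close>, hence
  the probability \<open>\<delta>\<close>. The tolerance \<open>\<epsilon>\<close> must be small
  against \<open>\<delta>\<close>, the second height \<open>\<eta>\<close> depends on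
  \<open>\<epsilon>\<close>, the approximation \<open>H\<close> on \<open>\<eta>\<close>, and
  \<open>A'\<close> comes last, avoiding relations on the finitely many exponents of
  \<open>H\<close>. No circle arises because \<open>\<delta>\<close> does not see \<open>A'\<close>.
  The set \<open>\<Lambda>\<close> of common relations is used twice: a cancellation in F_A must
  persist for every \<open>y\<close>, so \<open>A'\<close> has to merge the terms that
  \<open>A\<close> merges; and a relation of \<open>A'\<close> met in \<open>H\<close> must also
  hold for \<open>A\<close>, or the mean over \<open>y\<close> could depend on
  \<open>x\<close>.\<close>

definition unit_exp :: "real \<Rightarrow> complex" where
  "unit_exp t = exp (2 * of_real pi * \<i> * of_real t)"

text \<open>The measure lives on the circle itself, so that every point of the space, not only
  almost every one, has modulus 1.\<close>

definition circle_measure :: "complex measure" where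
  "circle_measure = distr (uniform_measure lborel {0..1}) (restrict_space borel (sphere 0 1)) unit_exp"

abbreviation torus :: "nat \<Rightarrow> (nat \<Rightarrow> complex) measure" where
  "torus l \<equiv> PiM {..<l} (\<lambda>_. circle_measure)"

lemma unit_exp_eq_cis: "unit_exp t = cis (2 * pi * t)"
  by (simp add: unit_exp_def cis_conv_exp mult_ac)

lemma unit_exp_add: "unit_exp (s + t) = unit_exp s * unit_exp t"
  by (simp add: unit_exp_eq_cis cis_mult algebra_simps)

lemma unit_exp_1 [simp]: "unit_exp 1 = 1"
  by (simp add: unit_exp_eq_cis)

lemma norm_unit_exp [simp]: "norm (unit_exp t) = 1"
  by (simp add: unit_exp_eq_cis)

lemma unit_exp_measurable [measurable]: "unit_exp \<in> borel_measurable borel"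
  unfolding unit_exp_def by measurable

lemma unit_exp_measurable_sphere [measurable]:
  "unit_exp \<in> measurable borel (restrict_space borel (sphere 0 1))"
  by (rule measurable_restrict_space2) auto

lemma obtain_unit_exp:
  assumes "norm w = 1"
  obtains s where "0 \<le> s" "s \<le> 1" "w = unit_exp s"
proof -
  obtain t where t: "0 \<le> t" "t < 2 * pi" "w = cis t"
    using assms by (metis Arg2pi_ge_0 Arg2pi_lt_2pi Arg2pi_eq cis_conv_exp complex_norm_eq_1_exp
        mult.commute mult_1 of_real_1)
  show thesis
    by (rule that[of "t / (2 * pi)"]) (use t in \<open>auto simp: unit_exp_eq_cis field_simps\<close>)
qed

lemma space_circle [simp]: "space circle_measure = sphere 0 1"
  by (simp add: circle_measure_def space_restrict_space)

lemma sets_circle [measurable_cong, simp]: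
  "sets circle_measure = sets (restrict_space borel (sphere 0 1))"
  by (simp add: circle_measure_def)

lemma prob_space_uniform_unit: "prob_space (uniform_measure lborel {0..1::real})"
  by (rule prob_space_uniform_measure) auto

lemma prob_space_circle [simp]: "prob_space circle_measure"
  unfolding circle_measure_def
  by (rule prob_space.prob_space_distr[OF prob_space_uniform_unit]) simp

lemma emeasure_circle:
  assumes "A \<in> sets (restrict_space borel (sphere 0 1))"
  shows "emeasure circle_measure A = emeasure lborel ({0..1} \<inter> unit_exp -` A)"
proof -
  have "unit_exp -` A \<in> sets borel"
    using measurable_sets[OF unit_exp_measurable_sphere assms] by simp
  then show ?thesis
    using assms unfolding circle_measure_def
    by (subst emeasure_distr) (auto simp: emeasure_uniform_measure divide_ennreal_def)
qed

lemma emeasure_lborel_translate: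
  assumes "X \<in> sets borel"
  shows "emeasure lborel ((\<lambda>t. t + c) -` X) = emeasure lborel (X :: real set)"
proof -
  have eq: "(\<lambda>t. t + c) = (+) c"
    by (simp add: fun_eq_iff)
  have "emeasure (distr lborel borel (\<lambda>t. c + t)) X = emeasure lborel ((\<lambda>t. t + c) -` X)"
    using assms by (subst emeasure_distr) (simp_all add: assms eq)
  then show ?thesis
    by (simp add: lborel_distr_plus)
qed

text \<open>Rotation by \<open>unit_exp s\<close> turns the parameter interval from 0 to 1 into the
  one from \<open>s\<close> to \<open>1 + s\<close>; by periodicity the part beyond 1 moves back to
  the start.\<close>

lemma circle_rotation:
  assumes w: "norm w = 1"
  shows "distr circle_measure circle_measure (\<lambda>z. w * z) = circle_measure"
proof (rule measure_eqI)
  have [measurable]: "(\<lambda>z. w * z) \<in> measurable (restrict_space borel (sphere 0 1)) (restrict_space borel (sphere 0 1))"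
    by (intro measurable_restrict_space2 measurable_restrict_space1)
       (auto simp: space_restrict_space norm_mult w)
  have m: "(\<lambda>z. w * z) \<in> measurable circle_measure circle_measure"
    by measurable
  fix A assume "A \<in> sets (distr circle_measure circle_measure (\<lambda>z. w * z))"
  then have A: "A \<in> sets (restrict_space borel (sphere 0 1))" by simp
  obtain s where s: "0 \<le> s" "s \<le> 1" "w = unit_exp s"
    using obtain_unit_exp[OF w] .
  define B where "B = unit_exp -` A"
  have B [measurable]: "B \<in> sets borel"
    using measurable_sets[OF unit_exp_measurable_sphere A] by (simp add: B_def)
  have per: "t + 1 \<in> B \<longleftrightarrow> t \<in> B" for t
    by (simp add: B_def unit_exp_add)
  \<comment> \<open>Without the left endpoint, a null set, adjacent intervals are disjoint and their
    measures add up.\<close>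
  have Ioc: "emeasure lborel ({a..b} \<inter> B) = emeasure lborel ({a<..b} \<inter> B)" if "a \<le> b" for a b
  proof (rule emeasure_eq_AE)
    show "AE x in lborel. (x \<in> {a..b} \<inter> B) = (x \<in> {a<..b} \<inter> B)"
      using AE_lborel_singleton[of a] by eventually_elim auto
  qed auto
  have "{0..1} \<inter> unit_exp -` ((\<lambda>z. w * z) -` A \<inter> space circle_measure) =
     (\<lambda>t. t + s) -` ({s..1+s} \<inter> B)"
    by (auto simp: B_def s unit_exp_add mult.commute)
  then have "emeasure (distr circle_measure circle_measure (\<lambda>z. w * z)) A =
      emeasure lborel ((\<lambda>t. t + s) -` ({s..1+s} \<inter> B))"
    using A m measurable_sets[OF m, of A] by (simp add: emeasure_distr emeasure_circle)
  also have "\<dots> = emeasure lborel ({s..1+s} \<inter> B)"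
    by (rule emeasure_lborel_translate) simp
  also have "\<dots> = emeasure lborel ({s<..1+s} \<inter> B)"
    using s by (intro Ioc) auto
  also have "{s<..1+s} \<inter> B = ({s<..1} \<inter> B) \<union> ({1<..1+s} \<inter> B)"
    using s by auto
  also have "emeasure lborel \<dots> = emeasure lborel ({s<..1} \<inter> B) + emeasure lborel ({1<..1+s} \<inter> B)"
    by (subst plus_emeasure) auto
  also have "emeasure lborel ({1<..1+s} \<inter> B) = emeasure lborel ((\<lambda>t. t + 1) -` ({1<..1+s} \<inter> B))"
    by (rule emeasure_lborel_translate[symmetric]) simp
  also have "(\<lambda>t. t + 1) -` ({1<..1+s} \<inter> B) = {0<..s} \<inter> B"
    by (auto simp: per)
  also have "emeasure lborel ({s<..1} \<inter> B) + emeasure lborel ({0<..s} \<inter> B) =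
      emeasure lborel ({0<..1} \<inter> B)"
    using s by (subst plus_emeasure) (auto intro!: arg_cong[of _ _ "emeasure lborel"])
  also have "\<dots> = emeasure circle_measure A"
    using A Ioc[of 0 1] by (simp add: emeasure_circle B_def)
  finally show "emeasure (distr circle_measure circle_measure (\<lambda>z. w * z)) A = emeasure circle_measure A" .
qed simp

lemma circle_rotation_measurable [measurable]:
  assumes "norm w = 1"
  shows "(\<lambda>z. w * z) \<in> measurable circle_measure circle_measure"
proof -
  have "(\<lambda>z. w * z) \<in> measurable (restrict_space borel (sphere 0 1)) (restrict_space borel (sphere 0 1))"
    by (intro measurable_restrict_space2 measurable_restrict_space1)
       (auto simp: space_restrict_space norm_mult assms)
  then show ?thesis by measurable
qed

lemma prob_space_torus: "prob_space (torus l)"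
  by (rule prob_space_PiM) simp

interpretation circle: prob_space circle_measure by simp
interpretation torus: prob_space "torus l" for l by (rule prob_space_torus)
interpretation circle_product: product_sigma_finite "\<lambda>_::nat. circle_measure" by unfold_locales

lemma space_torus: "space (torus l) = {..<l} \<rightarrow>\<^sub>E sphere 0 1"
  by (simp add: space_PiM)

lemma norm_torus: "z \<in> space (torus l) \<Longrightarrow> i < l \<Longrightarrow> norm (z i) = 1"
  by (auto simp: space_torus PiE_iff)

text \<open>The restriction keeps the product extensional, hence inside the space of the product
  measure.\<close>

definition torus_mult :: "nat \<Rightarrow> (nat \<Rightarrow> complex) \<Rightarrow> (nat \<Rightarrow> complex) \<Rightarrow> nat \<Rightarrow> complex" where
  "torus_mult l s z = (\<lambda>i\<in>{..<l}. s i * z i)"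

lemma torus_mult_commute: "torus_mult l s z = torus_mult l z s"
  by (simp add: torus_mult_def mult.commute)

lemma torus_mult_in_space:
  "s \<in> space (torus l) \<Longrightarrow> z \<in> space (torus l) \<Longrightarrow> torus_mult l s z \<in> space (torus l)"
  by (auto simp: space_torus torus_mult_def norm_mult PiE_iff)

lemma measurable_torus_component [measurable]:
  assumes "i < l"
  shows "(\<lambda>z. z i) \<in> borel_measurable (torus l)"
proof -
  have "(\<lambda>z. z i) \<in> measurable (torus l) circle_measure"
    using assms by (intro measurable_component_singleton) auto
  moreover have "(\<lambda>z. z) \<in> borel_measurable circle_measure"
    by (simp add: measurable_cong_sets[OF sets_circle refl] measurable_restrict_space1)
  ultimately show ?thesis
    by (rule measurable_compose)
qed

lemma torus_mult_measurable_pair [measurable]: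
  "(\<lambda>(s, z). torus_mult l s z) \<in> measurable (torus l \<Otimes>\<^sub>M torus l) (torus l)"
  unfolding torus_mult_def case_prod_beta
proof (rule measurable_restrict)
  fix i assume i: "i \<in> {..<l}"
  have "(\<lambda>p. fst p i * snd p i) \<in> measurable (torus l \<Otimes>\<^sub>M torus l) (restrict_space borel (sphere 0 1))"
  proof (rule measurable_restrict_space2)
    show "(\<lambda>p. fst p i * snd p i) \<in> space (torus l \<Otimes>\<^sub>M torus l) \<rightarrow> sphere 0 1"
      using i by (auto simp: space_pair_measure norm_mult norm_torus)
    have "(\<lambda>z. z i) \<in> borel_measurable (torus l)"
      using i by simp
    then show "(\<lambda>p. fst p i * snd p i) \<in> borel_measurable (torus l \<Otimes>\<^sub>M torus l)"
      by (intro borel_measurable_times) (auto intro: measurable_compose[OF measurable_fst] measurable_compose[OF measurable_snd])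
  qed
  then show "(\<lambda>p. fst p i * snd p i) \<in> measurable (torus l \<Otimes>\<^sub>M torus l) circle_measure"
    by (simp add: measurable_cong_sets[OF refl sets_circle])
qed

lemma torus_mult_measurable [measurable]:
  assumes "s \<in> space (torus l)"
  shows "torus_mult l s \<in> measurable (torus l) (torus l)"
  using measurable_Pair2[OF torus_mult_measurable_pair assms] by simp

text \<open>A shift pulls a box back to a box with rotated sides, so the invariance of the product
  measure follows from that of each factor.\<close>

lemma torus_shift:
  assumes s: "s \<in> space (torus l)"
  shows "distr (torus l) (torus l) (torus_mult l s) = torus l"
proof (rule circle_product.PiM_eqI)
  fix A assume A: "\<And>i. i \<in> {..<l} \<Longrightarrow> A i \<in> sets circle_measure"
  have PA: "Pi\<^sub>E {..<l} A \<in> sets (torus l)"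
    using A by (intro sets_PiM_I_finite) auto
  have rot: "(\<lambda>z. s i * z) \<in> measurable circle_measure circle_measure" if "i < l" for i
    using that s by (intro circle_rotation_measurable norm_torus)
  define A' where "A' i = (\<lambda>z. s i * z) -` A i \<inter> space circle_measure" for i
  have A': "A' i \<in> sets circle_measure" if "i < l" for i
    using measurable_sets[OF rot[OF that] A] that by (simp add: A'_def)
  have eq: "torus_mult l s -` Pi\<^sub>E {..<l} A \<inter> space (torus l) = Pi\<^sub>E {..<l} A'"
  proof (intro equalityI subsetI)
    fix z assume z: "z \<in> torus_mult l s -` Pi\<^sub>E {..<l} A \<inter> space (torus l)"
    have z1: "z \<in> {..<l} \<rightarrow>\<^sub>E sphere 0 1"
      using z by (simp add: space_torus)
    show "z \<in> Pi\<^sub>E {..<l} A'"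
    proof (rule PiE_I)
      fix i assume i: "i \<in> {..<l}"
      have "torus_mult l s z i \<in> A i"
        using z i PiE_mem by fastforce
      then show "z i \<in> A' i"
        using i PiE_mem[OF z1 i] by (simp add: A'_def torus_mult_def)
    qed (rule PiE_arb[OF z1])
  next
    fix z assume z: "z \<in> Pi\<^sub>E {..<l} A'"
    have mem: "z i \<in> A' i" if "i \<in> {..<l}" for i
      using PiE_mem[OF z that] .
    have "z \<in> {..<l} \<rightarrow>\<^sub>E sphere 0 1"
      using mem by (intro PiE_I PiE_arb[OF z]) (simp_all add: A'_def)
    moreover have "torus_mult l s z \<in> Pi\<^sub>E {..<l} A"
      using mem by (intro PiE_I) (simp_all add: A'_def torus_mult_def)
    ultimately show "z \<in> torus_mult l s -` Pi\<^sub>E {..<l} A \<inter> space (torus l)"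
      by (simp add: space_torus)
  qed
  have "emeasure (distr (torus l) (torus l) (torus_mult l s)) (Pi\<^sub>E {..<l} A) =
      emeasure (torus l) (Pi\<^sub>E {..<l} A')"
    by (simp only: emeasure_distr[OF torus_mult_measurable[OF s] PA] eq)
  also have "\<dots> = (\<Prod>i<l. emeasure circle_measure (A' i))"
    using A' by (subst circle_product.emeasure_PiM) auto
  also have "\<dots> = (\<Prod>i<l. emeasure circle_measure (A i))"
  proof (rule prod.cong)
    fix i assume i: "i \<in> {..<l}"
    have "emeasure circle_measure (A i) = emeasure (distr circle_measure circle_measure (\<lambda>z. s i * z)) (A i)"
      using i s by (subst circle_rotation) (auto intro: norm_torus)
    also have "\<dots> = emeasure circle_measure (A' i)"
      using i A rot by (subst emeasure_distr) (auto simp: A'_def)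
    finally show "emeasure circle_measure (A' i) = emeasure circle_measure (A i)" ..
  qed simp
  finally show "emeasure (distr (torus l) (torus l) (torus_mult l s)) (Pi\<^sub>E {..<l} A) =
      (\<Prod>i<l. emeasure circle_measure (A i))" .
qed auto

lemma integral_torus_shift:
  fixes f :: "_ \<Rightarrow> 'b :: {banach, second_countable_topology}"
  assumes s: "s \<in> space (torus l)" and [measurable]: "f \<in> borel_measurable (torus l)"
  shows "(\<integral>z. f (torus_mult l s z) \<partial>torus l) = (\<integral>z. f z \<partial>torus l)"
proof -
  have "(\<integral>z. f z \<partial>torus l) = (\<integral>z. f z \<partial>distr (torus l) (torus l) (torus_mult l s))"
    by (simp only: torus_shift[OF s])
  also have "\<dots> = (\<integral>z. f (torus_mult l s z) \<partial>torus l)"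
    using s by (intro integral_distr) auto
  finally show ?thesis ..
qed

text \<open>The density form matches the set integral in \<open>mahler_measure\<close>, while
  \<open>torus_eq_distr\<close> pushes the same product measure onto the torus.\<close>

lemma uniform_PiM_eq:
  "PiM {..<l::nat} (\<lambda>_. uniform_measure lborel {0..1::real}) =
    density (PiM {..<l} (\<lambda>_. lborel)) (indicator (\<Pi>\<^sub>E i\<in>{..<l}. {0..1}))"
proof -
  interpret P: product_sigma_finite "\<lambda>_::nat. lborel :: real measure"
    by unfold_locales
  interpret U: product_sigma_finite "\<lambda>_::nat. uniform_measure lborel {0..1::real}"
    by (intro product_sigma_finite.intro prob_space_imp_sigma_finite prob_space_uniform_unit)
  show ?thesis
  proof (rule U.PiM_eqI[symmetric])
  have box: "(\<Pi>\<^sub>E i\<in>{..<l}. {0..1::real}) \<in> sets (PiM {..<l} (\<lambda>_. lborel))"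
    by (intro sets_PiM_I_finite) auto
  fix A :: "nat \<Rightarrow> real set" assume A: "\<And>i. i \<in> {..<l} \<Longrightarrow> A i \<in> sets (uniform_measure lborel {0..1})"
  have "Pi\<^sub>E {..<l} A \<in> sets (PiM {..<l} (\<lambda>_. lborel))"
    using A by (intro sets_PiM_I_finite) auto
  then have "emeasure (density (PiM {..<l} (\<lambda>_. lborel)) (indicator (\<Pi>\<^sub>E i\<in>{..<l}. {0..1}))) (Pi\<^sub>E {..<l} A) =
     emeasure (PiM {..<l} (\<lambda>_. lborel)) ((\<Pi>\<^sub>E i\<in>{..<l}. {0..1}) \<inter> Pi\<^sub>E {..<l} A)"
    using box by (subst emeasure_density) (auto simp: indicator_inter_arith[symmetric])
  also have "(\<Pi>\<^sub>E i\<in>{..<l}. {0..1}) \<inter> Pi\<^sub>E {..<l} A = Pi\<^sub>E {..<l} (\<lambda>i. {0..1} \<inter> A i)"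
    by (rule PiE_Int)
  also have "emeasure (PiM {..<l} (\<lambda>_. lborel)) \<dots> = (\<Prod>i<l. emeasure lborel ({0..1} \<inter> A i))"
    using A by (intro P.emeasure_PiM) auto
  also have "\<dots> = (\<Prod>i<l. emeasure (uniform_measure lborel {0..1}) (A i))"
    using A by (intro prod.cong) (auto simp: emeasure_uniform_measure divide_ennreal_def)
  finally show "emeasure (density (PiM {..<l} (\<lambda>_. lborel)) (indicator (\<Pi>\<^sub>E i\<in>{..<l}. {0..1}))) (Pi\<^sub>E {..<l} A) =
      (\<Prod>i<l. emeasure (uniform_measure lborel {0..1}) (A i))" .
qed (auto intro!: sets_PiM_cong)
qed

lemma torus_eq_distr:
  "torus l = distr (PiM {..<l} (\<lambda>_. uniform_measure lborel {0..1})) (torus l) (compose {..<l} unit_exp)"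
proof -
  have "distr (PiM {..<l} (\<lambda>_. uniform_measure lborel {0..1})) (torus l) (compose {..<l} unit_exp) =
     PiM {..<l} (\<lambda>_. distr (uniform_measure lborel {0..1}) circle_measure unit_exp)"
    by (rule distr_PiM_finite_prob_space') (auto intro: prob_space_uniform_unit)
  also have "distr (uniform_measure lborel {0..1}) circle_measure unit_exp = circle_measure"
    by (subst (2) circle_measure_def, rule distr_cong) auto
  finally show ?thesis ..
qed

subsection \<open>Characters\<close>

interpretation torus_pair: pair_prob_space "torus l" "torus l'" for l l'
  by unfold_locales

definition chi :: "(nat \<Rightarrow>\<^sub>0 int) \<Rightarrow> (nat \<Rightarrow> complex) \<Rightarrow> complex" where
  "chi e z = (\<Prod>i\<in>Poly_Mapping.keys e. z i powi Poly_Mapping.lookup e i)"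

abbreviation exps_below :: "nat \<Rightarrow> (nat \<Rightarrow>\<^sub>0 int) set" where
  "exps_below l \<equiv> {e. Poly_Mapping.keys e \<subseteq> {..<l}}"

lemma chi_eq_prod: "e \<in> exps_below l \<Longrightarrow> chi e z = (\<Prod>i<l. z i powi Poly_Mapping.lookup e i)"
  unfolding chi_def by (rule prod_powi_superset) simp

lemma exps_below_add: "e \<in> exps_below l \<Longrightarrow> f \<in> exps_below l \<Longrightarrow> e + f \<in> exps_below l"
  using Poly_Mapping.keys_add[of e f] by auto

lemma exps_below_uminus: "e \<in> exps_below l \<Longrightarrow> - e \<in> exps_below l"
  by simp

lemma exps_below_diff: "e \<in> exps_below l \<Longrightarrow> f \<in> exps_below l \<Longrightarrow> e - f \<in> exps_below l"
  using exps_below_add[of e l "- f"] by simp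

lemma chi_0 [simp]: "chi 0 z = 1"
  by (simp add: chi_def)

lemma chi_measurable [measurable]:
  assumes "e \<in> exps_below l"
  shows "chi e \<in> borel_measurable (torus l)"
proof -
  have [measurable]: "(\<lambda>x::complex. x powi n) \<in> borel_measurable borel" for n
    unfolding power_int_def by measurable
  show ?thesis
    unfolding chi_eq_prod[OF assms, abs_def]
    by (intro borel_measurable_prod measurable_compose[OF measurable_torus_component]) auto
qed

lemma norm_chi:
  assumes "e \<in> exps_below l" "\<And>i. i < l \<Longrightarrow> norm (z i) = 1"
  shows "norm (chi e z) = 1"
  unfolding chi_eq_prod[OF assms(1)] using assms(2)
  by (simp add: prod_norm[symmetric] norm_power_int)

lemma chi_add:
  assumes "e \<in> exps_below l" "f \<in> exps_below l" "\<And>i. i < l \<Longrightarrow> norm (z i) = 1"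
  shows "chi (e + f) z = chi e z * chi f z"
proof -
  have "z i \<noteq> 0" if "i < l" for i
    using assms(3)[OF that] by auto
  then show ?thesis
    unfolding chi_eq_prod[OF assms(1)] chi_eq_prod[OF assms(2)] chi_eq_prod[OF exps_below_add[OF assms(1,2)]]
    by (simp add: lookup_add power_int_add flip: prod.distrib)
qed

lemma chi_uminus: "chi (- e) z = inverse (chi e z)"
  by (simp add: chi_def power_int_minus prod_inversef[symmetric] o_def)

lemma chi_diff:
  assumes "e \<in> exps_below l" "f \<in> exps_below l" "\<And>i. i < l \<Longrightarrow> norm (z i) = 1"
  shows "chi (e - f) z = chi e z / chi f z"
  using chi_add[OF assms(1) exps_below_uminus[OF assms(2)] assms(3)]
  by (simp add: chi_uminus divide_inverse)

lemma chi_torus_mult: "e \<in> exps_below l \<Longrightarrow> chi e (torus_mult l s z) = chi e s * chi e z"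
  by (simp add: chi_eq_prod torus_mult_def power_int_mult_distrib prod.distrib)

lemma norm_chi_torus: "e \<in> exps_below l \<Longrightarrow> z \<in> space (torus l) \<Longrightarrow> norm (chi e z) = 1"
  by (rule norm_chi) (auto intro: norm_torus)

lemma unit_exp_powi: "unit_exp t powi n = unit_exp (of_int n * t)"
  by (simp add: unit_exp_eq_cis cis_power_int algebra_simps)

text \<open>One coordinate with nonzero exponent suffices: a root of \<open>w\<close> goes there and
  1 everywhere else. The lemma is applied with \<open>w = -1\<close>.\<close>

lemma chi_surj:
  assumes e: "e \<in> exps_below l" "e \<noteq> 0" and w: "norm w = 1"
  obtains s where "s \<in> space (torus l)" "chi e s = w"
proof -
  obtain i where i: "Poly_Mapping.lookup e i \<noteq> 0"
    using e(2) by (metis lookup_zero poly_mapping_eqI)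
  then have il: "i < l"
    using e(1) by (auto simp: in_keys_iff)
  obtain t where t: "w = unit_exp t"
    using obtain_unit_exp[OF w] by metis
  define v where "v = unit_exp (t / of_int (Poly_Mapping.lookup e i))"
  define s where "s = (\<lambda>j\<in>{..<l}. if j = i then v else 1)"
  have "chi e s = (\<Prod>j<l. if j = i then v powi Poly_Mapping.lookup e j else 1)"
    unfolding chi_eq_prod[OF e(1)] by (rule prod.cong) (auto simp: s_def)
  also have "\<dots> = v powi Poly_Mapping.lookup e i"
    using il by simp
  also have "\<dots> = w"
    using i by (simp add: v_def unit_exp_powi t)
  finally have "chi e s = w" .
  moreover have "s \<in> space (torus l)"
    by (auto simp: s_def space_torus v_def)
  ultimately show thesis
    by (rule that[rotated])
qed

text \<open>A shift by a point where the character is -1 negates the integrand and preserves the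
  integral.\<close>

lemma integral_chi:
  assumes e: "e \<in> exps_below l" "e \<noteq> 0"
  shows "(\<integral>z. chi e z \<partial>torus l) = 0"
proof -
  obtain s where s: "s \<in> space (torus l)" "chi e s = -1"
    using chi_surj[OF e, of "-1"] by auto
  have "(\<integral>z. chi e z \<partial>torus l) = (\<integral>z. chi e (torus_mult l s z) \<partial>torus l)"
    using e by (intro integral_torus_shift[symmetric] s) simp
  also have "\<dots> = - (\<integral>z. chi e z \<partial>torus l)"
    using e(1) s(2) by (simp add: chi_torus_mult)
  finally show ?thesis by simp
qed

lemma integrable_chi: "e \<in> exps_below l \<Longrightarrow> integrable (torus l) (chi e)"
  by (rule torus.integrable_const_bound[of _ 1]) (auto simp: norm_chi_torus)

section \<open>Distribution of a single character near 1\<close>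

lemma measure_torus_shift:
  assumes s: "s \<in> space (torus l)" and P: "{z \<in> space (torus l). P z} \<in> sets (torus l)"
  shows "measure (torus l) {z \<in> space (torus l). P (torus_mult l s z)} =
    measure (torus l) {z \<in> space (torus l). P z}"
proof -
  have "measure (torus l) {z \<in> space (torus l). P z} =
      measure (distr (torus l) (torus l) (torus_mult l s)) {z \<in> space (torus l). P z}"
    by (simp only: torus_shift[OF s])
  also have "\<dots> = measure (torus l) (torus_mult l s -` {z \<in> space (torus l). P z} \<inter> space (torus l))"
    by (rule measure_distr[OF torus_mult_measurable[OF s] P])
  also have "torus_mult l s -` {z \<in> space (torus l). P z} \<inter> space (torus l) =
      {z \<in> space (torus l). P (torus_mult l s z)}"
    using s torus_mult_in_space by auto
  finally show ?thesis ..
qed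

text \<open>A squaring argument, uniform in the exponent. The sets where the character is near 1 and
  near -1 are disjoint, equally large by a shift, and both contained in the set where the square
  \<open>chi (e + e)\<close> is within \<open>2 * d\<close> of 1. So each halving of
  \<open>d\<close> halves the bound.\<close>

lemma chi_near_1_dyadic:
  assumes "e \<in> exps_below l" "e \<noteq> 0" "d \<le> (1/2) ^ k"
  shows "measure (torus l) {z \<in> space (torus l). norm (chi e z - 1) < d} \<le> (1/2) ^ k"
  using assms
proof (induction k arbitrary: e d)
  case 0
  then show ?case by simp
next
  case (Suc k)
  note e = Suc.prems(1,2)
  have [measurable]: "chi e \<in> borel_measurable (torus l)"
    using e(1) by (rule chi_measurable)
  have ee: "e + e \<in> exps_below l"
    using e(1) by (intro exps_below_add)
  then have [measurable]: "chi (e + e) \<in> borel_measurable (torus l)"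
    by (rule chi_measurable)
  have "e + e \<noteq> 0"
  proof
    assume "e + e = 0"
    then have "Poly_Mapping.lookup e i + Poly_Mapping.lookup e i = 0" for i
      by (metis lookup_add lookup_zero)
    then show False
      using e(2) by (metis add_eq_0_iff equal_neg_zero lookup_zero poly_mapping_eqI)
  qed
  obtain s where s: "s \<in> space (torus l)" "chi e s = -1"
    using chi_surj[OF e, of "-1"] by auto
  let ?A = "{z \<in> space (torus l). norm (chi e z - 1) < d}"
  let ?B = "{z \<in> space (torus l). norm (chi e z + 1) < d}"
  have "measure (torus l) ?A = measure (torus l) {z \<in> space (torus l). norm (chi e (torus_mult l s z) - 1) < d}"
    by (intro measure_torus_shift[symmetric] s(1)) measurable
  also have "{z \<in> space (torus l). norm (chi e (torus_mult l s z) - 1) < d} = ?B"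
    using e(1) s(2) by (simp add: chi_torus_mult norm_minus_commute flip: norm_minus_cancel[of "_ + 1"])
  finally have AB: "measure (torus l) ?A = measure (torus l) ?B" .
  have "?A \<inter> ?B = {}"
  proof -
    have False if "norm (chi e z - 1) < d" "norm (chi e z + 1) < d" for z
    proof -
      have "norm ((chi e z + 1) - (chi e z - 1)) \<le> norm (chi e z + 1) + norm (chi e z - 1)"
        by (rule norm_triangle_ineq4)
      moreover have "(1/2::real) ^ k \<le> 1"
        by (rule power_le_one) auto
      ultimately show False
        using that Suc.prems(3) by simp
    qed
    then show ?thesis by auto
  qed
  then have "2 * measure (torus l) ?A = measure (torus l) (?A \<union> ?B)"
    using AB by (subst torus.finite_measure_Union) auto
  also have "\<dots> \<le> measure (torus l) {z \<in> space (torus l). norm (chi (e + e) z - 1) < 2 * d}"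
  proof (rule torus.finite_measure_mono)
    have "norm (chi (e + e) z - 1) < 2 * d"
      if z: "z \<in> space (torus l)" and d: "norm (chi e z - 1) < d \<or> norm (chi e z + 1) < d" for z
    proof -
      have 1: "norm (chi e z) = 1"
        using e(1) z by (rule norm_chi_torus)
      have "chi (e + e) z - 1 = (chi e z - 1) * (chi e z + 1)"
        using chi_add[OF e(1) e(1), of z] z by (simp add: norm_torus algebra_simps)
      then have eq: "norm (chi (e + e) z - 1) = norm (chi e z - 1) * norm (chi e z + 1)"
        by (simp add: norm_mult)
      have "norm (chi e z - 1) \<le> 2" "norm (chi e z + 1) \<le> 2"
        using norm_triangle_ineq4[of "chi e z" 1] norm_triangle_ineq[of "chi e z" 1] 1 by simp_all
      then have "norm (chi e z - 1) * norm (chi e z + 1) \<le> norm (chi e z - 1) * 2"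
          "norm (chi e z - 1) * norm (chi e z + 1) \<le> 2 * norm (chi e z + 1)"
        by (auto intro!: mult_left_mono mult_right_mono)
      then show ?thesis
        using d eq by auto
    qed
    then show "?A \<union> ?B \<subseteq> {z \<in> space (torus l). norm (chi (e + e) z - 1) < 2 * d}"
      by auto
  qed measurable
  also have "\<dots> \<le> (1/2) ^ k"
    using Suc.prems(3) by (intro Suc.IH ee \<open>e + e \<noteq> 0\<close>) simp
  finally show ?case by simp
qed

lemma chi_near_1:
  assumes "e \<in> exps_below l" "e \<noteq> 0" "0 < d"
  shows "measure (torus l) {z \<in> space (torus l). norm (chi e z - 1) < d} \<le> 2 * d"
proof (cases "d \<le> 1")
  case True
  obtain n where "(1/2) ^ n < d"
    using real_arch_pow_inv[OF \<open>0 < d\<close>, of "1/2"] by auto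
  moreover have "(1/2::real) ^ Suc n \<le> (1/2) ^ n"
    by simp
  ultimately have ex: "\<exists>k. (1/2) ^ Suc k < d"
    by (meson le_less_trans)
  \<comment> \<open>\<open>(1/2) ^ k\<close> is at least \<open>d\<close> and less than
    \<open>2 * d\<close>; this rounding is the source of the factor 2.\<close>
  define k where "k = (LEAST k. (1/2) ^ Suc k < d)"
  have k: "(1/2) ^ Suc k < d"
    unfolding k_def by (rule LeastI_ex[OF ex])
  have "d \<le> (1/2) ^ k"
  proof (cases k)
    case (Suc m)
    then have "\<not> (1/2) ^ Suc m < d"
      using not_less_Least[of m "\<lambda>k. (1/2) ^ Suc k < d"] by (simp add: k_def)
    then show ?thesis using Suc by simp
  qed (use True in simp)
  from chi_near_1_dyadic[OF assms(1,2) this] k show ?thesis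
    by simp
next
  case False
  then show ?thesis
    by (intro order_trans[OF torus.prob_le_1]) simp
qed

text \<open>Keeping the set of exponents apart from the coefficients lets the proofs drop a term, or
  let the coefficients depend on a second torus point, without forming a new Laurent
  polynomial.\<close>

definition trig_poly :: "(nat \<Rightarrow>\<^sub>0 int) set \<Rightarrow> ((nat \<Rightarrow>\<^sub>0 int) \<Rightarrow> complex) \<Rightarrow> (nat \<Rightarrow> complex) \<Rightarrow> complex" where
  "trig_poly S c z = (\<Sum>e\<in>S. c e * chi e z)"

lemma laurent_eval_eq_trig_poly:
  "laurent_eval G = trig_poly (Poly_Mapping.keys G) (Poly_Mapping.lookup G)"
  by (simp add: laurent_eval_def trig_poly_def chi_def fun_eq_iff)

lemma trig_poly_measurable [measurable]:
  assumes "S \<subseteq> exps_below l"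
  shows "trig_poly S c \<in> borel_measurable (torus l)"
  unfolding trig_poly_def [abs_def] using assms
  by (intro borel_measurable_sum borel_measurable_times chi_measurable) auto

lemma norm_trig_poly_le:
  assumes "S \<subseteq> exps_below l" "z \<in> space (torus l)"
  shows "norm (trig_poly S c z) \<le> (\<Sum>e\<in>S. norm (c e))"
  unfolding trig_poly_def using assms
  by (intro order_trans[OF norm_sum] sum_mono) (auto simp: norm_mult norm_chi_torus)

subsection \<open>Sublevel sets of trigonometric polynomials\<close>

text \<open>For independent uniform \<open>s\<close> and \<open>z\<close>, the point
  \<open>z\<close> and its shift by \<open>s\<close> are again independent and uniform, so both lie
  in \<open>E\<close> with probability the square of its measure.\<close>

lemma measure_power2_eq_integral_shift:
  assumes E [measurable]: "E \<in> sets (torus l)"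
  shows "(measure (torus l) E)\<^sup>2 =
    (\<integral>s. measure (torus l) {z \<in> space (torus l). z \<in> E \<and> torus_mult l s z \<in> E} \<partial>torus l)"
proof -
  define f :: "(nat \<Rightarrow> complex) \<Rightarrow> (nat \<Rightarrow> complex) \<Rightarrow> real" where
    "f s z = indicator E z * indicator E (torus_mult l s z)" for s z
  have [measurable]: "indicator E \<in> borel_measurable (torus l)"
    using E by simp
  have meas: "case_prod f \<in> borel_measurable (torus l \<Otimes>\<^sub>M torus l)"
    unfolding f_def case_prod_beta
    by (intro borel_measurable_times measurable_compose[OF measurable_snd]
        measurable_compose[OF torus_mult_measurable_pair[unfolded case_prod_beta]]) auto
  have "integrable (torus l \<Otimes>\<^sub>M torus l) (case_prod f)"
    by (rule torus_pair.P.integrable_const_bound[of _ 1] meas)+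
       (auto simp: f_def indicator_def meas)
  then have "(\<integral>z. (\<integral>s. f s z \<partial>torus l) \<partial>torus l) = (\<integral>s. (\<integral>z. f s z \<partial>torus l) \<partial>torus l)"
    by (rule torus_pair.Fubini_integral)
  also have "(\<integral>s. (\<integral>z. f s z \<partial>torus l) \<partial>torus l) =
      (\<integral>s. measure (torus l) {z \<in> space (torus l). z \<in> E \<and> torus_mult l s z \<in> E} \<partial>torus l)"
  proof (rule Bochner_Integration.integral_cong[OF refl])
    fix s assume s: "s \<in> space (torus l)"
    have [measurable]: "torus_mult l s \<in> measurable (torus l) (torus l)"
      using s by (rule torus_mult_measurable)
    have "(\<integral>z. f s z \<partial>torus l) =
        (\<integral>z. indicator {z \<in> space (torus l). z \<in> E \<and> torus_mult l s z \<in> E} z \<partial>torus l)"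
      by (intro Bochner_Integration.integral_cong) (auto simp: f_def indicator_def)
    then show "(\<integral>z. f s z \<partial>torus l) =
        measure (torus l) {z \<in> space (torus l). z \<in> E \<and> torus_mult l s z \<in> E}"
      by simp
  qed
  also have "(\<integral>z. (\<integral>s. f s z \<partial>torus l) \<partial>torus l) = (\<integral>z. indicator E z * measure (torus l) E \<partial>torus l)"
  proof (rule Bochner_Integration.integral_cong[OF refl])
    fix z assume z: "z \<in> space (torus l)"
    have "(\<integral>s. f s z \<partial>torus l) = indicator E z * (\<integral>s. indicator E (torus_mult l z s) \<partial>torus l)"
      by (simp add: f_def torus_mult_commute[of l z])
    also have "(\<integral>s. indicator E (torus_mult l z s) \<partial>torus l) = (\<integral>s. (indicator E s :: real) \<partial>torus l)"
      by (rule integral_torus_shift[OF z]) simp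
    finally show "(\<integral>s. f s z \<partial>torus l) = indicator E z * measure (torus l) E"
      by simp
  qed
  finally show ?thesis
    by (simp add: power2_eq_square)
qed

text \<open>Dividing the shifted function by \<open>chi d s\<close> aligns the two terms with
  exponent \<open>d\<close>, so they cancel; every other coefficient picks up the factor
  \<open>chi (e - d) s - 1\<close>.\<close>

lemma trig_poly_shift_diff:
  assumes S: "finite S" "S \<subseteq> exps_below l" "d \<in> S"
    and s: "s \<in> space (torus l)" and z: "z \<in> space (torus l)"
  shows "trig_poly (S - {d}) (\<lambda>e. c e * (chi (e - d) s - 1)) z =
    trig_poly S c (torus_mult l s z) / chi d s - trig_poly S c z"
proof -
  have d: "d \<in> exps_below l" using S by auto
  have nz: "chi d s \<noteq> 0"
    using norm_chi_torus[OF d s] by auto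
  have "trig_poly (S - {d}) (\<lambda>e. c e * (chi (e - d) s - 1)) z =
      trig_poly S (\<lambda>e. c e * (chi (e - d) s - 1)) z"
    unfolding trig_poly_def using S by (intro sum.mono_neutral_left) auto
  also have "\<dots> = (\<Sum>e\<in>S. c e * chi e (torus_mult l s z) / chi d s - c e * chi e z)"
    unfolding trig_poly_def
  proof (rule sum.cong[OF refl])
    fix e assume "e \<in> S"
    then have e: "e \<in> exps_below l" using S by auto
    have "chi (e - d) s = chi e s / chi d s"
      by (rule chi_diff[OF e d]) (rule norm_torus[OF s])
    then show "c e * (chi (e - d) s - 1) * chi e z =
        c e * chi e (torus_mult l s z) / chi d s - c e * chi e z"
      using nz by (simp add: chi_torus_mult[OF e] field_simps)
  qed
  also have "\<dots> = trig_poly S c (torus_mult l s z) / chi d s - trig_poly S c z"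
    by (simp add: trig_poly_def sum_subtractf sum_divide_distrib)
  finally show ?thesis .
qed

text \<open>The induction removes one term at a time: if \<open>z\<close> and \<open>s z\<close> both lie in the sublevel
  set of \<open>f\<close>, then \<open>z\<close> lies in a sublevel set of \<open>f (s z) / \<chi> s - f z\<close>, in which the
  term with character \<open>\<chi>\<close> has cancelled.\<close>

lemma trig_poly_sublevel:
  "\<exists>C \<kappa>. 1 \<le> C \<and> 0 < \<kappa> \<and> \<kappa> \<le> 1 \<and>
    (\<forall>l S c e0 y. finite S \<longrightarrow> card S \<le> Suc N \<longrightarrow> S \<subseteq> exps_below l \<longrightarrow> e0 \<in> S \<longrightarrow>
       1 \<le> norm (c e0) \<longrightarrow> 0 < y \<longrightarrow>
       measure (torus l) {z \<in> space (torus l). norm (trig_poly S c z) < y} \<le> C * y powr \<kappa>)"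
proof (induction N)
  case 0
  have "measure (torus l) {z \<in> space (torus l). norm (trig_poly S c z) < y} \<le> 1 * y powr 1"
    if "finite S" "card S \<le> Suc 0" "S \<subseteq> exps_below l" "e0 \<in> S" "1 \<le> norm (c e0)" "0 < y"
    for l S c e0 y
  proof (cases "1 \<le> y")
    case True
    then show ?thesis
      using that by (intro order_trans[OF torus.prob_le_1]) simp
  next
    case False
    have "S = {e0}"
      using that card_le_Suc0_iff_eq by blast
    then have eq: "{z \<in> space (torus l). norm (trig_poly S c z) < y} = {}"
      using that False by (auto simp: trig_poly_def norm_mult norm_chi_torus)
    show ?thesis
      unfolding eq using that by simp
  qed
  then show ?case
    by (intro exI[of _ 1]) auto
next
  case (Suc N)
  then obtain C \<kappa> where C: "1 \<le> C" "0 < \<kappa>" "\<kappa> \<le> 1" and IH: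
    "\<And>l S c e0 y. finite S \<Longrightarrow> card S \<le> Suc N \<Longrightarrow> S \<subseteq> exps_below l \<Longrightarrow> e0 \<in> S \<Longrightarrow>
       1 \<le> norm (c e0) \<Longrightarrow> 0 < y \<Longrightarrow>
       measure (torus l) {z \<in> space (torus l). norm (trig_poly S c z) < y} \<le> C * y powr \<kappa>"
    by blast
  \<comment> \<open>Integrating the bound on \<open>h\<close> gives at most
    \<open>C' * y powr (\<kappa> / 2)\<close> for the square of the measure. The root has exponent
    \<open>\<kappa> / 4\<close>, and \<open>C'\<close> dominates its own root because it is at least
    1.\<close>
  define C' where "C' = 2 + 2 * C"
  have C': "1 \<le> C'" using C by (simp add: C'_def)
  have "measure (torus l) {z \<in> space (torus l). norm (trig_poly S c z) < y} \<le> C' * y powr (\<kappa> / 4)"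
    if S: "finite S" "card S \<le> Suc (Suc N)" "S \<subseteq> exps_below l" "e0 \<in> S" "1 \<le> norm (c e0)" "0 < y"
    for l S c e0 y
  proof (cases "1 \<le> y")
    case True
    have "1 * 1 \<le> C' * y powr (\<kappa> / 4)"
      using C' C True by (intro mult_mono ge_one_powr_ge_zero) auto
    then show ?thesis
      by (intro order_trans[OF torus.prob_le_1]) simp
  next
    case False
    define E where "E = {z \<in> space (torus l). norm (trig_poly S c z) < y}"
    have E [measurable]: "E \<in> sets (torus l)"
      unfolding E_def using trig_poly_measurable[OF S(3)] by measurable
    show ?thesis
    proof (cases "S = {e0}")
      case True
      then have "E = {}"
        using S \<open>\<not> 1 \<le> y\<close> by (auto simp: E_def trig_poly_def norm_mult norm_chi_torus)
      then show ?thesis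
        using S C' unfolding E_def[symmetric] by simp
    next
      case False
      \<comment> \<open>The term to be removed differs from \<open>e0\<close>, so that the
        coefficient known to be large survives.\<close>
      then obtain d where d: "d \<in> S" "d \<noteq> e0"
        using S(4) by auto
      have e0d: "e0 - d \<in> exps_below l" "e0 - d \<noteq> 0"
        using exps_below_diff[OF subsetD[OF S(3,4)] subsetD[OF S(3) d(1)]] d(2) by auto
      \<comment> \<open>The square root balances two losses: the bad set \<open>B\<close> has
        measure at most \<open>2 * \<delta>\<close>, and for \<open>s\<close> outside
        \<open>B\<close> the new coefficient at \<open>e0\<close> is only known to be at least
        \<open>\<delta>\<close>, so that rescaling it to 1 raises the level \<open>2 * y\<close> to
        \<open>2 * \<delta>\<close>.\<close>
      define \<delta> where "\<delta> = sqrt y"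
      have \<delta>: "0 < \<delta>" "\<delta> * \<delta> = y"
        using S(6) by (simp_all add: \<delta>_def)
      define B where "B = {s \<in> space (torus l). norm (chi (e0 - d) s - 1) < \<delta>}"
      have B [measurable]: "B \<in> sets (torus l)"
        unfolding B_def using chi_measurable[OF e0d(1)] by measurable
      define h where "h s = measure (torus l) {z \<in> space (torus l). z \<in> E \<and> torus_mult l s z \<in> E}" for s
      have h: "h s \<le> indicator B s + C * (2 * \<delta>) powr \<kappa>" if s: "s \<in> space (torus l)" for s
      proof (cases "s \<in> B")
        case True
        have "h s \<le> 1" by (simp add: h_def)
        then show ?thesis
          using True C by (simp add: add_increasing2)
      next
        case False
        define c' where "c' e = c e * (chi (e - d) s - 1) / of_real \<delta>" for e
        have tp: "trig_poly (S - {d}) c' z =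
            (trig_poly S c (torus_mult l s z) / chi d s - trig_poly S c z) / of_real \<delta>"
          if z: "z \<in> space (torus l)" for z
          unfolding trig_poly_shift_diff[OF S(1,3) d(1) s z, symmetric]
          by (simp add: trig_poly_def c'_def sum_divide_distrib)
        have "h s \<le> measure (torus l) {z \<in> space (torus l). norm (trig_poly (S - {d}) c' z) < 2 * \<delta>}"
          unfolding h_def
        proof (rule torus.finite_measure_mono)
          show "{z \<in> space (torus l). z \<in> E \<and> torus_mult l s z \<in> E} \<subseteq>
              {z \<in> space (torus l). norm (trig_poly (S - {d}) c' z) < 2 * \<delta>}"
          proof safe
            fix z assume z: "z \<in> space (torus l)" "z \<in> E" "torus_mult l s z \<in> E"
            have "d \<in> exps_below l" using S d by auto
            then have "norm (chi d s) = 1" using s by (rule norm_chi_torus)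
            then have "norm (trig_poly S c (torus_mult l s z) / chi d s - trig_poly S c z) < 2 * y"
              using z(2,3) norm_triangle_ineq4[of "trig_poly S c (torus_mult l s z) / chi d s" "trig_poly S c z"]
              by (simp add: E_def norm_divide)
            also have "2 * y = 2 * \<delta> * \<delta>" using \<delta> by simp
            finally show "norm (trig_poly (S - {d}) c' z) < 2 * \<delta>"
              using \<delta> by (simp add: tp[OF z(1)] norm_divide field_simps)
          qed
          have "S - {d} \<subseteq> exps_below l" using S by auto
          then show "{z \<in> space (torus l). norm (trig_poly (S - {d}) c' z) < 2 * \<delta>} \<in> sets (torus l)"
            using trig_poly_measurable[of "S - {d}" l c'] by measurable
        qed
        also have "\<dots> \<le> C * (2 * \<delta>) powr \<kappa>"
        proof (rule IH[of _ _ e0])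
          have "\<delta> \<le> norm (chi (e0 - d) s - 1)"
            using False s by (simp add: B_def)
          then have "1 * \<delta> \<le> norm (c e0) * norm (chi (e0 - d) s - 1)"
            using S(5) \<delta> by (intro mult_mono) auto
          moreover have "norm (c' e0) = norm (c e0) * norm (chi (e0 - d) s - 1) / \<delta>"
            using \<delta> by (simp add: c'_def norm_mult norm_divide)
          ultimately show "1 \<le> norm (c' e0)"
            using \<delta> by (simp add: le_divide_eq)
        qed (use S d \<delta> in auto)
        finally show ?thesis
          using False by simp
      qed
      have meas_h: "h \<in> borel_measurable (torus l)"
      proof -
        let ?Q = "(snd -` E \<inter> space (torus l \<Otimes>\<^sub>M torus l)) \<inter>
            ((\<lambda>(s, z). torus_mult l s z) -` E \<inter> space (torus l \<Otimes>\<^sub>M torus l))"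
        have "?Q \<in> sets (torus l \<Otimes>\<^sub>M torus l)"
          using E by (intro sets.Int measurable_sets[OF measurable_snd] measurable_sets[OF torus_mult_measurable_pair])
        then have "(\<lambda>s. measure (torus l) (Pair s -` ?Q)) \<in> borel_measurable (torus l)"
          unfolding measure_def
          by (intro measurable_compose[OF torus.measurable_emeasure_Pair]) auto
        moreover have "Pair s -` ?Q = {z \<in> space (torus l). z \<in> E \<and> torus_mult l s z \<in> E}"
          if "s \<in> space (torus l)" for s
          using that by (auto simp: space_pair_measure)
        ultimately show ?thesis
          unfolding h_def [abs_def] by (simp cong: measurable_cong)
      qed
      have integrable_B: "integrable (torus l) (indicator B :: _ \<Rightarrow> real)"
        by (rule integrable_real_indicator) (simp_all add: torus.emeasure_eq_measure)
      have "(measure (torus l) E)\<^sup>2 = (\<integral>s. h s \<partial>torus l)"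
        unfolding h_def using E by (rule measure_power2_eq_integral_shift)
      also have "\<dots> \<le> (\<integral>s. indicator B s + C * (2 * \<delta>) powr \<kappa> \<partial>torus l)"
      proof (rule integral_mono)
        show "integrable (torus l) h"
          using meas_h by (intro torus.integrable_const_bound[of h 1]) (auto simp: h_def)
        show "integrable (torus l) (\<lambda>s. indicator B s + C * (2 * \<delta>) powr \<kappa>)"
          by (intro Bochner_Integration.integrable_add integrable_B) simp
      qed (rule h)
      also have "\<dots> = measure (torus l) B + C * (2 * \<delta>) powr \<kappa>"
        using integrable_B by (simp add: torus.prob_space)
      also have "measure (torus l) B \<le> 2 * \<delta>"
        unfolding B_def by (rule chi_near_1[OF e0d \<delta>(1)])
      also have "C * (2 * \<delta>) powr \<kappa> \<le> 2 * C * \<delta> powr \<kappa>"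
      proof -
        have "2 powr \<kappa> \<le> (2::real) powr 1"
          using C by (intro powr_mono) auto
        then have "(2 powr \<kappa>) * (C * \<delta> powr \<kappa>) \<le> 2 * (C * \<delta> powr \<kappa>)"
          using C by (intro mult_right_mono) auto
        then show ?thesis
          using \<delta> by (simp add: powr_mult algebra_simps)
      qed
      also have "2 * \<delta> \<le> 2 * \<delta> powr \<kappa>"
      proof -
        have "\<delta> \<le> 1" using \<open>\<not> 1 \<le> y\<close> by (simp add: \<delta>_def)
        then have "\<delta> powr 1 \<le> \<delta> powr \<kappa>"
          using C \<delta> by (intro powr_mono') auto
        then show ?thesis using \<delta> by simp
      qed
      also have "2 * \<delta> powr \<kappa> + 2 * C * \<delta> powr \<kappa> = C' * (y powr (\<kappa> / 4))\<^sup>2"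
        using S(6) by (simp add: C'_def \<delta>_def powr_half_sqrt[symmetric] powr_powr algebra_simps
            flip: powr_realpow[of "y powr _"])
      also have "\<dots> \<le> (C' * y powr (\<kappa> / 4))\<^sup>2"
        using C' by (auto simp: power_mult_distrib intro!: mult_right_mono self_le_power)
      finally have "measure (torus l) E \<le> C' * y powr (\<kappa> / 4)"
        by (rule power2_le_imp_le) (use C' in auto)
      then show ?thesis by (simp add: E_def)
    qed
  qed
  then show ?case
    using C C' by (intro exI[of _ C'] exI[of _ "\<kappa> / 4"]) auto
qed


section \<open>Uniform integrability of the logarithm\<close>

lemma ln_max_half_diff:
  fixes a b :: real
  assumes "0 < b"
  shows "ln (max a b) - ln (max a (b / 2)) \<le> ln 2 * indicator {..<b} a"
proof (cases "a < b")
  case True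
  have "ln b - ln 2 = ln (b / 2)"
    using assms by (simp add: ln_div)
  also have "\<dots> \<le> ln (max a (b / 2))"
    using assms by simp
  finally show ?thesis using True by simp
qed (use assms in auto)

text \<open>Uniform integrability of \<open>ln \<bar>f\<bar>\<close> near the zeros of \<open>f\<close>: the bound \<open>\<eta>0\<close>
  depends on the number of terms of \<open>f\<close>, but neither on its exponents nor on the dimension of
  the torus.\<close>

lemma ln_trig_poly_truncation:
  fixes N :: nat and \<epsilon> :: real
  assumes "0 < \<epsilon>"
  obtains \<eta>0 where "0 < \<eta>0" "\<eta>0 \<le> 1"
    "\<And>\<eta> l S c e0. 0 < \<eta> \<Longrightarrow> \<eta> \<le> \<eta>0 \<Longrightarrow> finite S \<Longrightarrow> card S \<le> N \<Longrightarrow> S \<subseteq> exps_below l \<Longrightarrow>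
       e0 \<in> S \<Longrightarrow> 1 \<le> norm (c e0) \<Longrightarrow>
       (AE z in torus l. trig_poly S c z \<noteq> 0) \<and>
       integrable (torus l) (\<lambda>z. ln (norm (trig_poly S c z))) \<and>
       (\<integral>z. ln (max (norm (trig_poly S c z)) \<eta>) \<partial>torus l) \<le>
         (\<integral>z. ln (norm (trig_poly S c z)) \<partial>torus l) + \<epsilon>"
proof -
  obtain C \<kappa> where C: "1 \<le> C" "0 < \<kappa>" "\<kappa> \<le> 1" and sub:
    "\<And>l S c e0 y. finite S \<Longrightarrow> card S \<le> Suc N \<Longrightarrow> S \<subseteq> exps_below l \<Longrightarrow> e0 \<in> S \<Longrightarrow>
       1 \<le> norm (c e0) \<Longrightarrow> 0 < y \<Longrightarrow>
       measure (torus l) {z \<in> space (torus l). norm (trig_poly S c z) < y} \<le> C * y powr \<kappa>"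
    using trig_poly_sublevel[of N] by blast
  \<comment> \<open>Halving the height \<open>\<eta> * (1/2) ^ n\<close> costs at most
    \<open>ln 2\<close> times the measure of the set below it, which is bounded by a multiple of
    \<open>q ^ n\<close>. The geometric series bounds the total loss by
    \<open>B * \<eta> powr \<kappa>\<close>, and \<open>\<eta>0\<close> is chosen to make this at
    most \<open>\<epsilon>\<close>.\<close>
  define q where "q = (1/2::real) powr \<kappa>"
  have q: "0 < q" "q < 1"
    using C powr_less_mono2[of \<kappa> "1/2" 1] by (auto simp: q_def)
  define B where "B = ln 2 * C / (1 - q)"
  have B: "0 < B" using C q by (simp add: B_def)
  define \<eta>0 where "\<eta>0 = min 1 ((\<epsilon> / B) powr (1 / \<kappa>))"
  have \<eta>0: "0 < \<eta>0" "\<eta>0 \<le> 1"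
    using B \<open>0 < \<epsilon>\<close> by (auto simp: \<eta>0_def)
  have "(AE z in torus l. trig_poly S c z \<noteq> 0) \<and>
       integrable (torus l) (\<lambda>z. ln (norm (trig_poly S c z))) \<and>
       (\<integral>z. ln (max (norm (trig_poly S c z)) \<eta>) \<partial>torus l) \<le>
         (\<integral>z. ln (norm (trig_poly S c z)) \<partial>torus l) + \<epsilon>"
    if \<eta>: "0 < \<eta>" "\<eta> \<le> \<eta>0" and S: "finite S" "card S \<le> N" "S \<subseteq> exps_below l"
       "e0 \<in> S" "1 \<le> norm (c e0)" for \<eta> l S c e0
  proof -
    define f where "f z = norm (trig_poly S c z)" for z
    define L where "L = 1 + (\<Sum>e\<in>S. norm (c e))"
    have [measurable]: "f \<in> borel_measurable (torus l)"
      unfolding f_def [abs_def] using trig_poly_measurable[OF S(3)] by measurable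
    have L: "1 \<le> L"
      by (simp add: L_def sum_nonneg)
    have fL: "f z \<le> L" "0 \<le> f z" if "z \<in> space (torus l)" for z
      using norm_trig_poly_le[OF S(3) that, of c] by (auto simp: f_def L_def)
    have sub': "measure (torus l) {z \<in> space (torus l). f z < y} \<le> C * y powr \<kappa>" if "0 < y" for y
      unfolding f_def using S that by (intro sub) auto
    have AE0: "AE z in torus l. f z \<noteq> 0"
    proof -
      have small: "measure (torus l) {z \<in> space (torus l). f z = 0} \<le> \<delta>" if "0 < \<delta>" for \<delta>
      proof -
        have "measure (torus l) {z \<in> space (torus l). f z = 0} \<le>
            measure (torus l) {z \<in> space (torus l). f z < (\<delta> / C) powr (1 / \<kappa>)}"
          using that C by (intro torus.finite_measure_mono) auto
        also have "\<dots> \<le> C * ((\<delta> / C) powr (1 / \<kappa>)) powr \<kappa>"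
          using that C by (intro sub') auto
        also have "\<dots> = \<delta>"
          using that C by (simp add: powr_powr)
        finally show ?thesis .
      qed
      have "measure (torus l) {z \<in> space (torus l). f z = 0} \<le> 0"
        by (rule field_le_epsilon) (simp only: add_0 small)
      then have "measure (torus l) {z \<in> space (torus l). f z = 0} = 0"
        by (simp add: measure_le_0_iff)
      then show ?thesis
        by (subst AE_iff_measurable[of "{z \<in> space (torus l). f z = 0}"])
           (auto simp: torus.emeasure_eq_measure)
    qed
    define u where "u n z = ln (max (f z) (\<eta> * (1/2) ^ n))" for n z
    have ub: "\<bar>u n z\<bar> \<le> \<bar>ln L\<bar> + \<bar>ln (\<eta> * (1/2) ^ n)\<bar>" if "z \<in> space (torus l)" for n z
    proof -
      have "\<eta> * (1/2) ^ n \<le> 1 * 1"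
        using \<eta> \<eta>0 by (intro mult_mono power_le_one) auto
      then have "ln (max (f z) (\<eta> * (1/2) ^ n)) \<le> ln L"
        using fL[OF that] L \<eta> by (subst ln_le_cancel_iff) (auto simp: less_max_iff_disj)
      moreover have "ln (\<eta> * (1/2) ^ n) \<le> ln (max (f z) (\<eta> * (1/2) ^ n))"
        using \<eta> by (subst ln_le_cancel_iff) (auto simp: less_max_iff_disj)
      ultimately show ?thesis
        by (simp add: u_def)
    qed
    have int_u: "integrable (torus l) (u n)" for n
      using ub by (intro torus.integrable_const_bound[of _ "\<bar>ln L\<bar> + \<bar>ln (\<eta> * (1/2) ^ n)\<bar>"])
        (auto simp: u_def [abs_def])
    have step: "(\<integral>z. u n z \<partial>torus l) - (\<integral>z. u (Suc n) z \<partial>torus l) \<le> ln 2 * C * \<eta> powr \<kappa> * q ^ n" for n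
    proof -
      have "(\<integral>z. u n z \<partial>torus l) - (\<integral>z. u (Suc n) z \<partial>torus l) = (\<integral>z. u n z - u (Suc n) z \<partial>torus l)"
        by (intro Bochner_Integration.integral_diff[symmetric] int_u)
      also have "\<dots> \<le> (\<integral>z. ln 2 * indicator {z \<in> space (torus l). f z < \<eta> * (1/2) ^ n} z \<partial>torus l)"
      proof (rule integral_mono)
        fix z assume z: "z \<in> space (torus l)"
        show "u n z - u (Suc n) z \<le> ln 2 * indicator {z \<in> space (torus l). f z < \<eta> * (1/2) ^ n} z"
          using ln_max_half_diff[of "\<eta> * (1/2) ^ n" "f z"] \<eta> z
          by (simp add: u_def indicator_def)
      next
        show "integrable (torus l) (\<lambda>z. u n z - u (Suc n) z)"
          by (intro Bochner_Integration.integrable_diff int_u)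
        have "integrable (torus l) (indicator {z \<in> space (torus l). f z < \<eta> * (1/2) ^ n} :: _ \<Rightarrow> real)"
          by (rule integrable_real_indicator) (simp_all add: torus.emeasure_eq_measure)
        then show "integrable (torus l) (\<lambda>z. ln 2 * indicator {z \<in> space (torus l). f z < \<eta> * (1/2) ^ n} z :: real)"
          by simp
      qed
      also have "\<dots> = ln 2 * measure (torus l) {z \<in> space (torus l). f z < \<eta> * (1/2) ^ n}"
        by simp
      also have "\<dots> \<le> ln 2 * (C * (\<eta> * (1/2) ^ n) powr \<kappa>)"
        using \<eta> by (intro mult_left_mono sub') auto
      also have "(\<eta> * (1/2) ^ n) powr \<kappa> = \<eta> powr \<kappa> * q ^ n"
        using \<eta> by (simp add: powr_mult q_def powr_powr powr_realpow[symmetric] mult.commute)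
      finally show ?thesis by (simp add: mult_ac)
    qed
    have tot: "(\<integral>z. u 0 z \<partial>torus l) - (\<integral>z. u n z \<partial>torus l) \<le> \<epsilon>" for n
    proof -
      have "(\<integral>z. u 0 z \<partial>torus l) - (\<integral>z. u n z \<partial>torus l) =
          (\<Sum>j<n. (\<integral>z. u j z \<partial>torus l) - (\<integral>z. u (Suc j) z \<partial>torus l))"
        by (induction n) simp_all
      also have "\<dots> \<le> (\<Sum>j<n. ln 2 * C * \<eta> powr \<kappa> * q ^ j)"
        by (intro sum_mono step)
      also have "\<dots> = ln 2 * C * \<eta> powr \<kappa> * (\<Sum>j<n. q ^ j)"
        by (simp add: sum_distrib_left)
      also have "\<dots> \<le> ln 2 * C * \<eta> powr \<kappa> * (1 / (1 - q))"
        using q C by (intro mult_left_mono) (auto simp: sum_gp_strict divide_right_mono)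
      also have "\<dots> = B * \<eta> powr \<kappa>"
        by (simp add: B_def)
      also have "\<dots> \<le> B * ((\<epsilon> / B) powr (1 / \<kappa>)) powr \<kappa>"
        using \<eta> C B by (intro mult_left_mono powr_mono2) (auto simp: \<eta>0_def)
      also have "\<dots> = \<epsilon>"
        using C B \<open>0 < \<epsilon>\<close> by (simp add: powr_powr)
      finally show ?thesis .
    qed
    have mono: "u m z \<le> u n z" if "n \<le> m" for m n z
    proof -
      have le: "\<eta> * (1/2) ^ m \<le> \<eta> * (1/2) ^ n"
        using \<eta> that by (intro mult_left_mono power_decreasing) auto
      show ?thesis
        unfolding u_def using \<eta> max.mono[OF order_refl le, of "f z"]
        by (subst ln_le_cancel_iff) (auto simp: less_max_iff_disj)
    qed
    \<comment> \<open>The integrability of \<open>ln (f z)\<close> is not known beforehand. It comes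
      from monotone convergence: the integrals decrease and are bounded below by \<open>tot\<close>.
      The functions are negated below to make the sequence increasing.\<close>
    have "decseq (\<lambda>n. \<integral>z. u n z \<partial>torus l)"
      unfolding decseq_def by (intro allI impI integral_mono int_u mono)
    moreover have "(\<integral>z. u 0 z \<partial>torus l) - \<epsilon> \<le> (\<integral>z. u n z \<partial>torus l)" for n
      using tot[of n] by simp
    ultimately obtain x where x: "(\<lambda>n. \<integral>z. u n z \<partial>torus l) \<longlonglongrightarrow> x"
      using decseq_convergent by blast
    have u_lim: "(\<lambda>n. u n z) \<longlonglongrightarrow> ln (f z)" if "f z \<noteq> 0" for z
    proof -
      have "(\<lambda>n. max (f z) (\<eta> * (1/2) ^ n)) \<longlonglongrightarrow> max (f z) (\<eta> * 0)"
        by (intro tendsto_intros LIMSEQ_power_zero) auto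
      also have "max (f z) (\<eta> * 0) = f z"
        by (simp add: f_def)
      finally show ?thesis
        unfolding u_def using that by (intro tendsto_ln) auto
    qed
    have lim: "AE z in torus l. (\<lambda>n. - u n z) \<longlonglongrightarrow> - ln (f z)"
      using AE0 by eventually_elim (rule tendsto_minus[OF u_lim])
    have mono': "AE z in torus l. mono (\<lambda>n. - u n z)"
      by (intro AE_I2) (auto simp: mono_def intro: mono)
    have x': "(\<lambda>n. \<integral>z. - u n z \<partial>torus l) \<longlonglongrightarrow> - x"
      using tendsto_minus[OF x] by simp
    have meas: "(\<lambda>z. - ln (f z)) \<in> borel_measurable (torus l)"
      by measurable
    have int_u': "integrable (torus l) (\<lambda>z. - u n z)" for n
      using int_u by simp
    have "integrable (torus l) (\<lambda>z. - ln (f z))" "(\<integral>z. - ln (f z) \<partial>torus l) = - x"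
      by (rule integrable_monotone_convergence[OF int_u' mono' lim x' meas]
          integral_monotone_convergence[OF int_u' mono' lim x' meas])+
    moreover have "(\<integral>z. u 0 z \<partial>torus l) - \<epsilon> \<le> x"
      using x by (rule LIMSEQ_le_const) (use tot in \<open>auto simp: algebra_simps\<close>)
    ultimately show ?thesis
      using AE0 by (simp add: u_def f_def)
  qed
  with \<eta>0 show thesis
    by (intro that) 
qed

subsection \<open>Lower bounds for Mahler measures\<close>

lemma laurent_polys_keys: "G \<in> laurent_polys l \<longleftrightarrow> Poly_Mapping.keys G \<subseteq> exps_below l"
  by (auto simp: laurent_polys_def)

text \<open>\<open>G\<close> reads only coordinates below \<open>l\<close>, so the value
  \<open>undefined\<close> that \<open>compose\<close> assigns to the others is harmless when
  passing from the cube to the torus.\<close>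

lemma mahler_measure_eq_integral_torus:
  assumes G: "G \<in> laurent_polys l"
  shows "mahler_measure l G = (\<integral>z. ln (norm (laurent_eval G z)) \<partial>torus l)"
proof -
  have G': "Poly_Mapping.keys G \<subseteq> exps_below l"
    using G by (simp only: laurent_polys_keys)
  define f where "f z = ln (norm (laurent_eval G z))" for z
  have f [measurable]: "f \<in> borel_measurable (torus l)"
    unfolding f_def [abs_def] laurent_eval_eq_trig_poly
    using trig_poly_measurable[OF G'] by measurable
  define g where "g t = ln (norm (laurent_eval G (\<lambda>i. exp (2 * of_real pi * \<i> * of_real (t i)))))"
    for t :: "nat \<Rightarrow> real"
  have fg: "f (compose {..<l} unit_exp t) = g t" for t
  proof -
    have "laurent_eval G (compose {..<l} unit_exp t) =
        laurent_eval G (\<lambda>i. exp (2 * of_real pi * \<i> * of_real (t i)))"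
      unfolding laurent_eval_eq_trig_poly trig_poly_def
    proof (rule sum.cong[OF refl])
      fix e assume "e \<in> Poly_Mapping.keys G"
      then have "e \<in> exps_below l" using G' by auto
      then show "Poly_Mapping.lookup G e * chi e (compose {..<l} unit_exp t) =
          Poly_Mapping.lookup G e * chi e (\<lambda>i. exp (2 * of_real pi * \<i> * of_real (t i)))"
        by (simp add: chi_eq_prod compose_def unit_exp_def)
    qed
    then show ?thesis by (simp add: f_def g_def)
  qed
  have comp: "compose {..<l} unit_exp \<in> measurable (PiM {..<l} (\<lambda>_. M)) (torus l)"
    if [measurable_cong]: "sets M = sets (borel :: real measure)" for M
  proof -
    have "unit_exp \<in> measurable M circle_measure"
      by measurable
    then show ?thesis
      unfolding compose_def [abs_def]
      by (intro measurable_restrict measurable_compose[OF measurable_component_singleton]) auto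
  qed
  have g: "g \<in> borel_measurable (PiM {..<l} (\<lambda>_. lborel))"
    using measurable_compose[OF comp f, of lborel] by (simp add: fg)
  have "(\<integral>z. f z \<partial>torus l) = (\<integral>t. g t \<partial>PiM {..<l} (\<lambda>_. uniform_measure lborel {0..1}))"
    by (subst torus_eq_distr, subst integral_distr) (auto intro: comp simp: fg)
  also have "\<dots> = (\<integral>t. indicator (\<Pi>\<^sub>E i\<in>{..<l}. {0..1}) t *\<^sub>R g t \<partial>PiM {..<l} (\<lambda>_. lborel))"
    unfolding uniform_PiM_eq ennreal_indicator[symmetric]
    using g by (intro integral_density) (auto intro!: borel_measurable_indicator sets_PiM_I_finite)
  finally show ?thesis
    by (simp add: mahler_measure_def set_lebesgue_integral_def f_def g_def)
qed

text \<open>The constant coefficient 1 meets the normalisation in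
  \<open>ln_trig_poly_truncation\<close> for two terms, so one height \<open>\<eta>\<close> serves
  all \<open>m\<close> and all \<open>\<beta>\<close>, and a truncated mean is at least
  \<open>ln \<eta>\<close>. The doubling argument below relies on this uniformity, since it changes
  both parameters.\<close>

lemma torus_binomial_bound:
  obtains C where "\<And>m \<beta>. 0 < m \<Longrightarrow>
    (AE z in torus 1. 1 - \<beta> * z 0 ^ m \<noteq> 0) \<and>
    integrable (torus 1) (\<lambda>z. ln (norm (1 - \<beta> * z 0 ^ m))) \<and>
    - C \<le> (\<integral>z. ln (norm (1 - \<beta> * z 0 ^ m)) \<partial>torus 1)"
proof -
  obtain \<eta> where \<eta>: "0 < \<eta>" "\<eta> \<le> 1" and trunc:
    "\<And>l S c e0. finite S \<Longrightarrow> card S \<le> 2 \<Longrightarrow> S \<subseteq> exps_below l \<Longrightarrow>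
       e0 \<in> S \<Longrightarrow> 1 \<le> norm (c e0) \<Longrightarrow>
       (AE z in torus l. trig_poly S c z \<noteq> 0) \<and>
       integrable (torus l) (\<lambda>z. ln (norm (trig_poly S c z))) \<and>
       (\<integral>z. ln (max (norm (trig_poly S c z)) \<eta>) \<partial>torus l) \<le>
         (\<integral>z. ln (norm (trig_poly S c z)) \<partial>torus l) + 1"
    using ln_trig_poly_truncation[of 1 2] by (metis order_refl zero_less_one)
  have "(AE z in torus 1. 1 - \<beta> * z 0 ^ m \<noteq> 0) \<and>
    integrable (torus 1) (\<lambda>z. ln (norm (1 - \<beta> * z 0 ^ m))) \<and>
    - (1 - ln \<eta>) \<le> (\<integral>z. ln (norm (1 - \<beta> * z 0 ^ m)) \<partial>torus 1)" if m: "0 < m" for m \<beta>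
  proof -
    define e where "e = Poly_Mapping.single (0::nat) (int m)"
    have e: "Poly_Mapping.lookup e 0 = int m"
      unfolding e_def by (rule lookup_single_eq)
    have e': "Poly_Mapping.keys e = {0}"
      unfolding e_def keys_single using m by simp
    have e0: "e \<noteq> 0"
      using e m by (metis lookup_zero of_nat_0_less_iff less_irrefl)
    define S where "S = {0, e}"
    define c where "c f = (if f = 0 then 1 else - \<beta>)" for f :: "nat \<Rightarrow>\<^sub>0 int"
    have S: "finite S" "card S \<le> 2" "S \<subseteq> exps_below 1" "0 \<in> S"
      using e' by (auto simp: S_def card_insert_if)
    have tp: "trig_poly S c z = 1 - \<beta> * z 0 ^ m" for z
      using e e' e0 by (simp add: S_def c_def trig_poly_def chi_def)
    note * = trunc[OF S, of c, unfolded tp]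
    have "1 \<le> norm (c 0)" by (simp add: c_def)
    note * = *[OF this]
    have "ln \<eta> = (\<integral>z. ln \<eta> \<partial>torus 1)"
      by (simp add: torus.prob_space)
    also have "\<dots> \<le> (\<integral>z. ln (max (norm (1 - \<beta> * z 0 ^ m)) \<eta>) \<partial>torus 1)"
    proof (rule integral_mono_AE)
      have [measurable]: "(\<lambda>z. z 0) \<in> borel_measurable (torus 1)"
        by simp
      have "norm (ln (max (norm (1 - \<beta> * z 0 ^ m)) \<eta>)) \<le> \<bar>ln \<eta>\<bar> + \<bar>ln (1 + norm \<beta>)\<bar>"
        if z: "z \<in> space (torus 1)" for z
      proof -
        have "norm (1 - \<beta> * z 0 ^ m) \<le> 1 + norm \<beta>"
          using norm_triangle_ineq4[of 1 "\<beta> * z 0 ^ m"] norm_torus[OF z, of 0]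
          by (simp add: norm_mult norm_power)
        then have "ln (max (norm (1 - \<beta> * z 0 ^ m)) \<eta>) \<le> ln (1 + norm \<beta>)"
          using \<eta> by (subst ln_le_cancel_iff) (auto simp: less_max_iff_disj intro: add_increasing2 add_pos_nonneg)
        moreover have "ln \<eta> \<le> ln (max (norm (1 - \<beta> * z 0 ^ m)) \<eta>)"
          using \<eta> by (subst ln_le_cancel_iff) (auto simp: less_max_iff_disj)
        moreover have "0 \<le> ln (1 + norm \<beta>)"
          by simp
        ultimately show ?thesis
          unfolding real_norm_def by linarith
      qed
      then show "integrable (torus 1) (\<lambda>z. ln (max (norm (1 - \<beta> * z 0 ^ m)) \<eta>))"
        by (intro torus.integrable_const_bound[of _ "\<bar>ln \<eta>\<bar> + \<bar>ln (1 + norm \<beta>)\<bar>"]) auto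
      show "AE z in torus 1. ln \<eta> \<le> ln (max (norm (1 - \<beta> * z 0 ^ m)) \<eta>)"
        using \<eta> by (intro AE_I2) (subst ln_le_cancel_iff, auto simp: less_max_iff_disj)
    qed simp
    finally show ?thesis
      using * by auto
  qed
  then show thesis by (rule that)
qed

text \<open>Rotating \<open>z\<close> by an \<open>m\<close>-th root of \<open>-1\<close> gives
  \<open>\<integral> ln \<bar>1 - \<beta> z ^ m\<bar> = \<integral> ln \<bar>1 - \<beta>\<^sup>2 z ^ (2 m)\<bar> / 2\<close>, so that the uniform lower bound
  improves to \<open>0\<close>.\<close>

lemma torus_binomial_nonneg:
  assumes "0 < m"
  shows "0 \<le> (\<integral>z. ln (norm (1 - \<beta> * z 0 ^ m)) \<partial>torus 1)"
proof -
  obtain C where C: "\<And>m \<beta>. 0 < m \<Longrightarrow>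
    (AE z in torus 1. 1 - \<beta> * z 0 ^ m \<noteq> 0) \<and>
    integrable (torus 1) (\<lambda>z. ln (norm (1 - \<beta> * z 0 ^ m))) \<and>
    - C \<le> (\<integral>z. ln (norm (1 - \<beta> * z 0 ^ m)) \<partial>torus 1)"
    using torus_binomial_bound by blast
  define h where "h m \<beta> = (\<integral>z. ln (norm (1 - \<beta> * z 0 ^ m)) \<partial>torus 1)" for m and \<beta> :: complex
  have [measurable]: "(\<lambda>z. z 0) \<in> borel_measurable (torus 1)"
    by simp
  have double: "h (2 * m) (\<beta>\<^sup>2) = 2 * h m \<beta>" if m: "0 < m" for m \<beta>
  proof -
    define s where "s = (\<lambda>i\<in>{..<1::nat}. unit_exp (1 / (2 * real m)))"
    have s: "s \<in> space (torus 1)"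
      by (auto simp: s_def space_torus)
    have sm: "s 0 ^ m = -1"
      using m by (simp add: s_def unit_exp_eq_cis Complex.DeMoivre)
    have "h m \<beta> = (\<integral>z. ln (norm (1 - \<beta> * torus_mult 1 s z 0 ^ m)) \<partial>torus 1)"
      unfolding h_def by (rule integral_torus_shift[OF s, symmetric]) measurable
    also have "\<dots> = h m (- \<beta>)"
      by (simp add: h_def torus_mult_def power_mult_distrib sm)
    finally have "2 * h m \<beta> = h m \<beta> + h m (- \<beta>)"
      by simp
    also have "\<dots> = (\<integral>z. ln (norm (1 - \<beta> * z 0 ^ m)) + ln (norm (1 - (- \<beta>) * z 0 ^ m)) \<partial>torus 1)"
      unfolding h_def using C[OF m, of \<beta>] C[OF m, of "- \<beta>"]
      by (intro Bochner_Integration.integral_add[symmetric]) auto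
    also have "\<dots> = h (2 * m) (\<beta>\<^sup>2)"
      unfolding h_def
    proof (rule integral_cong_AE)
      have "AE z in torus 1. 1 - \<beta> * z 0 ^ m \<noteq> 0" "AE z in torus 1. 1 - (- \<beta>) * z 0 ^ m \<noteq> 0"
        using C[OF m] by blast+
      then show "AE z in torus 1. ln (norm (1 - \<beta> * z 0 ^ m)) + ln (norm (1 - (- \<beta>) * z 0 ^ m)) =
          ln (norm (1 - \<beta>\<^sup>2 * z 0 ^ (2 * m)))"
      proof eventually_elim
        case (elim z)
        have "1 - \<beta>\<^sup>2 * z 0 ^ (2 * m) = (1 - \<beta> * z 0 ^ m) * (1 - (- \<beta>) * z 0 ^ m)"
          by (simp add: algebra_simps power2_eq_square mult_2_right power_add)
        then show ?case
          using elim by (simp add: norm_mult ln_mult)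
      qed
    qed measurable
    finally show ?thesis ..
  qed
  have bound: "- C / 2 ^ k \<le> h m \<beta>" if "0 < m" for k m \<beta>
    using that
  proof (induction k arbitrary: m \<beta>)
    case 0
    then show ?case using C by (simp add: h_def)
  next
    case (Suc k)
    have "- C / 2 ^ k \<le> h (2 * m) (\<beta>\<^sup>2)"
      using Suc.prems by (intro Suc.IH) simp
    then show ?case
      using double[OF Suc.prems, of \<beta>] by (simp add: field_simps)
  qed
  have "(\<lambda>k. - C * (1/2) ^ k) \<longlonglongrightarrow> - C * 0"
    by (intro tendsto_mult tendsto_const LIMSEQ_power_zero) auto
  then have "- C * 0 \<le> h m \<beta>"
    by (rule LIMSEQ_le_const2) (use bound[OF assms] in \<open>auto simp: power_one_over field_simps\<close>)
  then show ?thesis by (simp add: h_def)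
qed

text \<open>Jensen's inequality on the circle. Splitting off a root \<open>a\<close>, which is
  nonzero, produces the constant \<open>- a\<close>, which accounts for the change of the value at
  0, and the binomial \<open>1 - z / a\<close>, whose logarithmic mean is nonnegative wherever
  \<open>a\<close> lies.\<close>

lemma ln_poly_0_le_integral:
  fixes q :: "complex poly"
  assumes "poly q 0 \<noteq> 0"
  shows "(AE z in torus 1. poly q (z 0) \<noteq> 0) \<and>
    integrable (torus 1) (\<lambda>z. ln (norm (poly q (z 0)))) \<and>
    ln (norm (poly q 0)) \<le> (\<integral>z. ln (norm (poly q (z 0))) \<partial>torus 1)"
  using assms
proof (induction "degree q" arbitrary: q rule: less_induct)
  case less
  have [measurable]: "(\<lambda>z. z 0) \<in> borel_measurable (torus 1)"
    by simp
  have meas: "(\<lambda>z. poly p (z 0)) \<in> borel_measurable (torus 1)" for p :: "complex poly"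
    unfolding poly_altdef by measurable
  show ?case
  proof (cases "degree q = 0")
    case True
    then obtain c where "q = [:c:]"
      by (metis degree_eq_zeroE)
    with less.prems show ?thesis
      by (simp add: torus.prob_space)
  next
    case False
    then obtain a where a: "poly q a = 0"
      using alg_closed_imp_poly_has_root[of q] by auto
    then obtain r where r: "q = [:- a, 1:] * r"
      by (metis poly_eq_0_iff_dvd dvdE)
    have a0: "a \<noteq> 0" and r0: "poly r 0 \<noteq> 0"
      using less.prems by (auto simp: r)
    have "r \<noteq> 0" using r0 by auto
    then have "degree r < degree q"
      using degree_mult_eq[of "[:- a, 1:]" r] by (simp add: r del: mult_pCons_left)
    note IH = less.hyps[OF this r0]
    obtain C where C: "\<And>m \<beta>. 0 < m \<Longrightarrow>
      (AE z in torus 1. 1 - \<beta> * z 0 ^ m \<noteq> 0) \<and>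
      integrable (torus 1) (\<lambda>z. ln (norm (1 - \<beta> * z 0 ^ m))) \<and>
      - C \<le> (\<integral>z. ln (norm (1 - \<beta> * z 0 ^ m)) \<partial>torus 1)"
      using torus_binomial_bound by blast
    note b = C[of 1 "1 / a", simplified] and b0 = torus_binomial_nonneg[of 1 "1 / a", simplified]
    have q: "poly q z = - a * (1 - 1 / a * z) * poly r z" for z
      using a0 by (simp add: r field_simps)
    have AE: "AE z in torus 1. ln (norm (poly q (z 0))) =
        ln (norm a) + ln (norm (1 - z 0 / a)) + ln (norm (poly r (z 0)))"
    proof -
      have "AE z in torus 1. 1 - z 0 / a \<noteq> 0" "AE z in torus 1. poly r (z 0) \<noteq> 0"
        using b IH by auto
      then show ?thesis
        by eventually_elim (simp add: q norm_mult ln_mult a0)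
    qed
    have int: "integrable (torus 1) (\<lambda>z. ln (norm a) + ln (norm (1 - z 0 / a)) + ln (norm (poly r (z 0))))"
      using b IH by (intro Bochner_Integration.integrable_add) auto
    have "AE z in torus 1. poly q (z 0) \<noteq> 0"
    proof -
      have "AE z in torus 1. 1 - z 0 / a \<noteq> 0" "AE z in torus 1. poly r (z 0) \<noteq> 0"
        using b IH by auto
      then show ?thesis
        by eventually_elim (simp add: q a0)
    qed
    moreover have "integrable (torus 1) (\<lambda>z. ln (norm (poly q (z 0))))"
      by (rule integrable_cong_AE_imp[OF int]) (use AE meas in auto)
    moreover have "(\<integral>z. ln (norm (poly q (z 0))) \<partial>torus 1) =
       (\<integral>z. ln (norm a) + ln (norm (1 - z 0 / a)) + ln (norm (poly r (z 0))) \<partial>torus 1)"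
      by (rule integral_cong_AE) (use AE meas in auto)
    moreover have "\<dots> = ln (norm a) + (\<integral>z. ln (norm (1 - z 0 / a)) \<partial>torus 1) +
        (\<integral>z. ln (norm (poly r (z 0))) \<partial>torus 1)"
      using b IH by (simp add: torus.prob_space)
    moreover have "ln (norm (poly q 0)) = ln (norm a) + ln (norm (poly r 0))"
      using a0 r0 by (simp add: q norm_mult ln_mult)
    ultimately show ?thesis
      using b0 IH by simp
  qed
qed

section \<open>Nonnegative means from a vertex of the Newton polytope\<close>

lemma integrable_ln_max_norm:
  assumes \<eta>: "0 < \<eta>" and [measurable]: "f \<in> borel_measurable M" and "prob_space M"
    and B: "\<And>z. z \<in> space M \<Longrightarrow> norm (f z) \<le> B"
  shows "integrable M (\<lambda>z. ln (max (norm (f z :: complex)) \<eta>))"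
proof (rule finite_measure.integrable_const_bound[where B = "\<bar>ln \<eta>\<bar> + \<bar>ln (max B \<eta>)\<bar>"])
  show "finite_measure M"
    using \<open>prob_space M\<close> by (simp add: prob_space.finite_measure)
  show "AE z in M. norm (ln (max (norm (f z)) \<eta>)) \<le> \<bar>ln \<eta>\<bar> + \<bar>ln (max B \<eta>)\<bar>"
  proof (rule AE_I2)
    fix z assume "z \<in> space M"
    then have "max (norm (f z)) \<eta> \<le> max B \<eta>"
      using B by (intro max.mono) auto
    then have "ln (max (norm (f z)) \<eta>) \<le> ln (max B \<eta>)"
      using \<eta> by (subst ln_le_cancel_iff) (auto simp: less_max_iff_disj)
    moreover have "ln \<eta> \<le> ln (max (norm (f z)) \<eta>)"
      using \<eta> by (subst ln_le_cancel_iff) (auto simp: less_max_iff_disj)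
    ultimately show "norm (ln (max (norm (f z)) \<eta>)) \<le> \<bar>ln \<eta>\<bar> + \<bar>ln (max B \<eta>)\<bar>"
      unfolding real_norm_def by linarith
  qed
qed simp

text \<open>An exponent \<open>e0\<close> of maximal Euclidean norm is a vertex of the Newton polytope, exposed
  by the linear functional \<open>e \<mapsto> e0 \<bullet> e\<close>. Along the one-parameter subgroups
  \<open>z s\<^bsup>-e0\<^esup>\<close> the function becomes, up to a unimodular factor, a polynomial in \<open>s\<close> with
  constant term \<open>c e0 \<chi> z\<close>.\<close>

lemma integral_ln_max_trig_poly_nonneg:
  assumes S: "finite S" "S \<noteq> {}" "S \<subseteq> exps_below l" and c: "\<And>e. e \<in> S \<Longrightarrow> 1 \<le> norm (c e)"
    and \<eta>: "0 < \<eta>"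
  shows "0 \<le> (\<integral>z. ln (max (norm (trig_poly S c z)) \<eta>) \<partial>torus l)"
proof -
  define dot where "dot e f = (\<Sum>i<l. Poly_Mapping.lookup e i * Poly_Mapping.lookup f i)"
    for e f :: "nat \<Rightarrow>\<^sub>0 int"
  obtain e0 where e0: "e0 \<in> S" and max: "\<And>e. e \<in> S \<Longrightarrow> dot e e \<le> dot e0 e0"
  proof -
    have "Max ((\<lambda>e. dot e e) ` S) \<in> (\<lambda>e. dot e e) ` S"
      using S by (intro Max_in) auto
    then obtain e0 where "e0 \<in> S" "dot e0 e0 = Max ((\<lambda>e. dot e e) ` S)"
      by auto
    then show ?thesis
      using S(1) by (intro that[of e0]) auto
  qed
  have dot_less: "dot e0 e < dot e0 e0" if e: "e \<in> S" "e \<noteq> e0" for e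
  proof -
    have "0 < dot (e0 - e) (e0 - e)"
    proof -
      obtain i where i: "Poly_Mapping.lookup (e0 - e) i \<noteq> 0"
        using e(2) by (metis eq_iff_diff_eq_0 lookup_zero poly_mapping_eqI)
      moreover have "e0 - e \<in> exps_below l"
        using S(3) e(1) e0 by (intro exps_below_diff) auto
      ultimately have "i < l"
        by (auto simp: in_keys_iff)
      then show ?thesis
        unfolding dot_def using i by (intro sum_pos2[of _ i]) (auto simp: zero_less_mult_iff)
    qed
    also have "dot (e0 - e) (e0 - e) = dot e0 e0 + dot e e - 2 * dot e0 e"
      by (simp add: dot_def lookup_minus algebra_simps sum.distrib sum_subtractf sum_distrib_left)
    finally show ?thesis
      using max[OF e(1)] by simp
  qed
  \<comment> \<open>On \<open>S\<close> the difference is nonnegative and vanishes only at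
    \<open>e0\<close>, so it can serve as a polynomial degree and only the vertex contributes to the
    constant term.\<close>
  define n where "n e = nat (dot e0 e0 - dot e0 e)" for e
  have n: "int (n e) = dot e0 e0 - dot e0 e" if "e \<in> S" for e
    using dot_less[OF that] by (cases "e = e0") (auto simp: n_def)
  define q where "q z = (\<Sum>e\<in>S. monom (c e * chi e z) (n e))" for z
  define t where "t s = (\<lambda>i\<in>{..<l}. s 0 powi (- Poly_Mapping.lookup e0 i))" for s :: "nat \<Rightarrow> complex"
  have t: "t s \<in> space (torus l)" if "s \<in> space (torus 1)" for s
    using norm_torus[OF that, of 0] by (auto simp: t_def space_torus norm_power_int)
  have tp: "norm (trig_poly S c (torus_mult l (t s) z)) = norm (poly (q z) (s 0))"
    if s: "s \<in> space (torus 1)" for s z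
  proof -
    have s0: "norm (s 0) = 1" "s 0 \<noteq> 0"
      using norm_torus[OF s, of 0] by auto
    have "chi e (t s) = s 0 powi (- dot e0 e)" if "e \<in> S" for e
    proof -
      have "e \<in> exps_below l" using that S by auto
      then have "chi e (t s) = (\<Prod>i<l. s 0 powi (- Poly_Mapping.lookup e0 i * Poly_Mapping.lookup e i))"
        by (simp add: chi_eq_prod t_def power_int_mult del: mult_minus_left)
      also have "\<dots> = s 0 powi (\<Sum>i<l. - Poly_Mapping.lookup e0 i * Poly_Mapping.lookup e i)"
        using s0 by (simp add: powi_sum)
      finally show ?thesis
        by (simp add: dot_def sum_negf)
    qed
    then have eq: "chi e (t s) = s 0 powi (- dot e0 e0) * s 0 ^ n e" if "e \<in> S" for e
      using that s0 by (simp add: power_int_add[symmetric] n flip: power_int_of_nat)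
    have "trig_poly S c (torus_mult l (t s) z) = s 0 powi (- dot e0 e0) * poly (q z) (s 0)"
      unfolding trig_poly_def q_def poly_sum sum_distrib_left
    proof (rule sum.cong[OF refl])
      fix e assume e: "e \<in> S"
      then have "e \<in> exps_below l" using S by auto
      then show "c e * chi e (torus_mult l (t s) z) =
          s 0 powi (- dot e0 e0) * poly (monom (c e * chi e z) (n e)) (s 0)"
        by (simp add: chi_torus_mult eq[OF e] poly_monom)
    qed
    then show ?thesis
      using s0 by (simp add: norm_mult norm_power_int)
  qed
  have [measurable]: "(\<lambda>s. s 0) \<in> borel_measurable (torus 1)"
    by simp
  define F where "F z s = poly (q z) (s 0)" for z and s :: "nat \<Rightarrow> complex"
  have F_le: "norm (F z s) \<le> (\<Sum>e\<in>S. norm (c e))" if "z \<in> space (torus l)" "s \<in> space (torus 1)" for z s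
    using norm_trig_poly_le[OF S(3) torus_mult_in_space[OF t[OF that(2)] that(1)], of c] tp[OF that(2)]
    by (simp add: F_def)
  have F_pair: "case_prod F \<in> borel_measurable (torus l \<Otimes>\<^sub>M torus 1)"
  proof -
    have "(\<lambda>p. chi e (fst p)) \<in> borel_measurable (torus l \<Otimes>\<^sub>M torus 1)" if "e \<in> S" for e
      using that S by (intro measurable_compose[OF measurable_fst] chi_measurable) auto
    moreover have "(\<lambda>p. snd p 0) \<in> borel_measurable (torus l \<Otimes>\<^sub>M torus 1)"
      by (intro measurable_compose[OF measurable_snd]) simp
    ultimately show ?thesis
      unfolding F_def q_def case_prod_beta poly_sum poly_monom
      by (intro borel_measurable_sum borel_measurable_times borel_measurable_power) auto
  qed
  have F_meas: "F z \<in> borel_measurable (torus 1)" for z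
    unfolding F_def [abs_def] poly_altdef by measurable
  \<comment> \<open>The mean is unchanged by the shift with any \<open>t s\<close>, hence also by
    averaging over \<open>s\<close>. Fubini then makes the inner integral one over \<open>s\<close>
    alone, where Jensen's inequality applies.\<close>
  have "(\<integral>z. ln (max (norm (trig_poly S c z)) \<eta>) \<partial>torus l) =
      (\<integral>s. (\<integral>z. ln (max (norm (F z s)) \<eta>) \<partial>torus l) \<partial>torus 1)" (is "?I = _")
  proof -
    have "(\<integral>z. ln (max (norm (F z s)) \<eta>) \<partial>torus l) = ?I" if s: "s \<in> space (torus 1)" for s
    proof -
      have [measurable]: "trig_poly S c \<in> borel_measurable (torus l)"
        by (rule trig_poly_measurable[OF S(3)])
      have "?I = (\<integral>z. ln (max (norm (trig_poly S c (torus_mult l (t s) z))) \<eta>) \<partial>torus l)"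
        by (intro integral_torus_shift[OF t[OF s], symmetric]) measurable
      then show ?thesis
        by (simp add: F_def tp[OF s])
    qed
    then have "(\<integral>s. (\<integral>z. ln (max (norm (F z s)) \<eta>) \<partial>torus l) \<partial>torus 1) = (\<integral>s. ?I \<partial>torus 1)"
      by (rule Bochner_Integration.integral_cong[OF refl])
    then show ?thesis
      by (simp add: torus.prob_space)
  qed
  also have "\<dots> = (\<integral>z. (\<integral>s. ln (max (norm (F z s)) \<eta>) \<partial>torus 1) \<partial>torus l)"
  proof (rule torus_pair.Fubini_integral)
    have "integrable (torus l \<Otimes>\<^sub>M torus 1) (\<lambda>p. ln (max (norm (case_prod F p)) \<eta>))"
      by (rule integrable_ln_max_norm[OF \<eta> F_pair torus_pair.P.prob_space_axioms, of "\<Sum>e\<in>S. norm (c e)"])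
         (auto simp: space_pair_measure F_le)
    then show "integrable (torus l \<Otimes>\<^sub>M torus 1) (\<lambda>(z, s). ln (max (norm (F z s)) \<eta>))"
      by (simp add: case_prod_unfold)
  qed
  also have "\<dots> \<ge> 0"
  proof (rule Bochner_Integration.integral_nonneg)
    fix z assume z: "z \<in> space (torus l)"
    have "poly (q z) 0 = (\<Sum>e\<in>S. if e = e0 then c e * chi e z else 0)"
      unfolding q_def poly_sum
    proof (rule sum.cong[OF refl])
      fix e assume "e \<in> S"
      then have "n e = 0 \<longleftrightarrow> e = e0"
        using n[of e] dot_less[of e] by (cases "e = e0") (auto simp: n_def)
      then show "poly (monom (c e * chi e z) (n e)) 0 = (if e = e0 then c e * chi e z else 0)"
        by (simp add: poly_monom zero_power_eq)
    qed
    also have "\<dots> = c e0 * chi e0 z"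
      using S(1) e0 by simp
    finally have "poly (q z) 0 = c e0 * chi e0 z" .
    moreover have "norm (chi e0 z) = 1"
      using S(3) e0 z by (intro norm_chi_torus) auto
    ultimately have q0: "1 \<le> norm (poly (q z) 0)"
      using c[OF e0] by (simp add: norm_mult)
    then have "poly (q z) 0 \<noteq> 0" by auto
    note q = ln_poly_0_le_integral[OF this]
    have "0 \<le> ln (norm (poly (q z) 0))"
      using q0 by simp
    also have "\<dots> \<le> (\<integral>s. ln (norm (F z s)) \<partial>torus 1)"
      using q by (simp add: F_def)
    also have "\<dots> \<le> (\<integral>s. ln (max (norm (F z s)) \<eta>) \<partial>torus 1)"
    proof (rule integral_mono_AE)
      show "integrable (torus 1) (\<lambda>s. ln (norm (F z s)))"
        using q by (simp add: F_def)
      show "integrable (torus 1) (\<lambda>s. ln (max (norm (F z s)) \<eta>))"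
        by (rule integrable_ln_max_norm[OF \<eta> F_meas torus.prob_space_axioms F_le[OF z]])
      have "AE s in torus 1. F z s \<noteq> 0"
        using q by (simp add: F_def)
      then show "AE s in torus 1. ln (norm (F z s)) \<le> ln (max (norm (F z s)) \<eta>)"
        by eventually_elim (subst ln_le_cancel_iff, auto simp: less_max_iff_disj)
    qed
    finally show "0 \<le> (\<integral>s. ln (max (norm (F z s)) \<eta>) \<partial>torus 1)" .
  qed
  finally show ?thesis .
qed

text \<open>Dirichlet's pigeonhole argument with measures: the tuple of cells containing the
  characters takes at most \<open>card I ^ n\<close> values, so one of them is taken on a set of
  measure at least \<open>\<delta>\<close>. Dividing that set by one of its points moves all these
  characters near 1. The count depends on \<open>\<rho>\<close> and \<open>n\<close> alone, not on
  the torus or on the exponents.\<close>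

lemma characters_simultaneously_near_1:
  fixes \<rho> :: real and n :: nat
  assumes "0 < \<rho>"
  shows "\<exists>\<delta>>0. \<forall>l (K :: 'a set) f. finite K \<longrightarrow> card K \<le> n \<longrightarrow> f ` K \<subseteq> exps_below l \<longrightarrow>
       \<delta> \<le> measure (torus l) {y \<in> space (torus l). \<forall>e\<in>K. norm (chi (f e) y - 1) < \<rho>}"
proof -
  \<comment> \<open>Cells have side \<open>1 / M\<close>, so two points of one cell differ by less
    than \<open>2 / M\<close>, which is below \<open>\<rho>\<close>.\<close>
  obtain M :: nat where M: "2 / \<rho> < real M" "0 < M"
    by (metis reals_Archimedean2 less_trans of_nat_0_less_iff zero_less_divide_iff zero_less_numeral assms)
  define cell where "cell w = (\<lfloor>real M * Re w\<rfloor>, \<lfloor>real M * Im w\<rfloor>)" for w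
  define I where "I = {- int M..int M} \<times> {- int M..int M}"
  have cell_I: "cell w \<in> I" if "norm w = 1" for w
  proof -
    have "\<bar>Re w\<bar> \<le> 1" "\<bar>Im w\<bar> \<le> 1"
      using that abs_Re_le_cmod[of w] abs_Im_le_cmod[of w] by auto
    then have "\<bar>real M * Re w\<bar> \<le> real M * 1" "\<bar>real M * Im w\<bar> \<le> real M * 1"
      unfolding abs_mult by (intro mult_mono; simp)+
    then show ?thesis
      by (auto simp: cell_def I_def le_floor_iff floor_le_iff abs_le_iff)
  qed
  have cell_near: "norm (v - w) < \<rho>" if "cell v = cell w" for v w
  proof -
    have "\<bar>real M * Re v - real M * Re w\<bar> < 1" "\<bar>real M * Im v - real M * Im w\<bar> < 1"
      using that unfolding cell_def prod.inject by linarith+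
    then have "real M * \<bar>Re (v - w)\<bar> < 1" "real M * \<bar>Im (v - w)\<bar> < 1"
      by (simp_all add: right_diff_distrib[symmetric] abs_mult)
    moreover have "norm (v - w) \<le> \<bar>Re (v - w)\<bar> + \<bar>Im (v - w)\<bar>"
      by (rule cmod_le)
    then have "real M * norm (v - w) \<le> real M * (\<bar>Re (v - w)\<bar> + \<bar>Im (v - w)\<bar>)"
      by (intro mult_left_mono) auto
    ultimately have "real M * norm (v - w) < 2"
      by (simp add: distrib_left)
    then show ?thesis
      using M assms by (smt (verit) mult.commute mult_less_cancel_left_pos of_nat_0_less_iff pos_divide_less_eq)
  qed
  define \<delta> where "\<delta> = 1 / real (card I) ^ n"
  have I: "finite I" "1 \<le> card I" "I \<noteq> {}"
    by (auto simp: I_def Suc_le_eq card_gt_0_iff)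
  then have \<delta>: "0 < \<delta>"
    by (simp add: \<delta>_def card_gt_0_iff)
  have "\<delta> \<le> measure (torus l) {y \<in> space (torus l). \<forall>e\<in>K. norm (chi (f e) y - 1) < \<rho>}"
    if K: "finite K" "card K \<le> n" "f ` K \<subseteq> exps_below l" for l and K :: "'a set" and f
  proof -
    have fK: "f e \<in> exps_below l" if "e \<in> K" for e
      using K(3) that by auto
    define E where "E a = {y \<in> space (torus l). \<forall>e\<in>K. cell (chi (f e) y) = a e}" for a
    have E: "E a \<in> sets (torus l)" for a
    proof -
      have "{y \<in> space (torus l). cell (chi (f e) y) = a e} \<in> sets (torus l)" if "e \<in> K" for e
      proof -
        have [measurable]: "chi (f e) \<in> borel_measurable (torus l)"
          using fK[OF that] by (rule chi_measurable)
        have "{y \<in> space (torus l). cell (chi (f e) y) = a e} =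
            {y \<in> space (torus l). \<lfloor>real M * Re (chi (f e) y)\<rfloor> = fst (a e) \<and> \<lfloor>real M * Im (chi (f e) y)\<rfloor> = snd (a e)}"
          by (auto simp: cell_def prod_eq_iff)
        also have "\<dots> \<in> sets (torus l)"
          by measurable
        finally show ?thesis .
      qed
      then show ?thesis
        unfolding E_def by (intro sets.sets_Collect_finite_All K(1))
    qed
    have "space (torus l) \<subseteq> (\<Union>a\<in>K \<rightarrow>\<^sub>E I. E a)"
    proof
      fix y assume y: "y \<in> space (torus l)"
      have "(\<lambda>e\<in>K. cell (chi (f e) y)) \<in> K \<rightarrow>\<^sub>E I"
        using norm_chi_torus[OF fK y] cell_I by auto
      moreover have "y \<in> E (\<lambda>e\<in>K. cell (chi (f e) y))"
        using y by (simp add: E_def)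
      ultimately show "y \<in> (\<Union>a\<in>K \<rightarrow>\<^sub>E I. E a)"
        by blast
    qed
    have fin: "finite (K \<rightarrow>\<^sub>E I)"
      using K(1) I by (intro finite_PiE) auto
    have "1 = measure (torus l) (space (torus l))"
      by (simp add: torus.prob_space)
    also have "\<dots> \<le> measure (torus l) (\<Union>a\<in>K \<rightarrow>\<^sub>E I. E a)"
      using \<open>space (torus l) \<subseteq> _\<close> fin E by (intro torus.finite_measure_mono) auto
    also have "\<dots> \<le> (\<Sum>a\<in>K \<rightarrow>\<^sub>E I. measure (torus l) (E a))"
      using fin E by (intro torus.finite_measure_subadditive_finite) auto
    finally have sum: "1 \<le> (\<Sum>a\<in>K \<rightarrow>\<^sub>E I. measure (torus l) (E a))" .
    have card: "card (K \<rightarrow>\<^sub>E I) \<le> card I ^ n"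
      using K I by (simp add: card_PiE power_increasing)
    have "\<exists>a. \<delta> \<le> measure (torus l) (E a)"
    proof (rule ccontr)
      assume "\<not> ?thesis"
      then have less: "measure (torus l) (E a) < \<delta>" for a
        by (simp add: not_le)
      have "K \<rightarrow>\<^sub>E I \<noteq> {}"
        using sum by auto
      then have "(\<Sum>a\<in>K \<rightarrow>\<^sub>E I. measure (torus l) (E a)) < (\<Sum>a\<in>K \<rightarrow>\<^sub>E I. \<delta>)"
        using fin less by (intro sum_strict_mono) auto
      also have "\<dots> = real (card (K \<rightarrow>\<^sub>E I)) * \<delta>"
        by simp
      also have "\<dots> \<le> real (card I ^ n) * \<delta>"
        using card by (intro mult_right_mono) (auto simp: \<delta>_def)
      also have "\<dots> = 1"
        using I by (simp add: \<delta>_def)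
      finally show False using sum by simp
    qed
    then obtain a where a: "\<delta> \<le> measure (torus l) (E a)" by blast
    then have "E a \<noteq> {}"
      using \<delta> by auto
    then obtain y0 where y0: "y0 \<in> E a" by blast
    then have y0s: "y0 \<in> space (torus l)" by (simp add: E_def)
    have "measure (torus l) (E a) = measure (torus l) {y \<in> space (torus l). torus_mult l y0 y \<in> E a}"
      using measure_torus_shift[OF y0s, of "\<lambda>y. y \<in> E a"] E[of a] sets.sets_into_space[OF E[of a]]
      by (simp add: Collect_conj_eq Int_absorb1 Int_commute)
    also have "\<dots> \<le> measure (torus l) {y \<in> space (torus l). \<forall>e\<in>K. norm (chi (f e) y - 1) < \<rho>}"
    proof (rule torus.finite_measure_mono)
      show "{y \<in> space (torus l). torus_mult l y0 y \<in> E a} \<subseteq>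
          {y \<in> space (torus l). \<forall>e\<in>K. norm (chi (f e) y - 1) < \<rho>}"
      proof safe
        fix y e assume y: "y \<in> space (torus l)" "torus_mult l y0 y \<in> E a" and e: "e \<in> K"
        have "cell (chi (f e) (torus_mult l y0 y)) = cell (chi (f e) y0)"
          using y y0 e by (simp add: E_def)
        then have "norm (chi (f e) y0 * chi (f e) y - chi (f e) y0) < \<rho>"
          by (intro cell_near) (simp add: chi_torus_mult[OF fK[OF e]])
        also have "chi (f e) y0 * chi (f e) y - chi (f e) y0 = chi (f e) y0 * (chi (f e) y - 1)"
          by (simp add: algebra_simps)
        finally show "norm (chi (f e) y - 1) < \<rho>"
          by (simp add: norm_mult norm_chi_torus[OF fK[OF e] y0s])
      qed
      show "{y \<in> space (torus l). \<forall>e\<in>K. norm (chi (f e) y - 1) < \<rho>} \<in> sets (torus l)"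
      proof (rule sets.sets_Collect_finite_All[OF _ K(1)])
        fix e assume "e \<in> K"
        then have [measurable]: "chi (f e) \<in> borel_measurable (torus l)"
          by (intro chi_measurable fK)
        show "{y \<in> space (torus l). norm (chi (f e) y - 1) < \<rho>} \<in> sets (torus l)"
          by measurable
      qed
    qed
    finally show ?thesis using a by simp
  qed
  with \<delta> show ?thesis by blast
qed

subsection \<open>Trigonometric approximation and generic kernels\<close>

lemma laurent_polys_sum:
  "(\<And>i. i \<in> I \<Longrightarrow> g i \<in> laurent_polys k) \<Longrightarrow> (\<Sum>i\<in>I. g i) \<in> laurent_polys k"
proof (induction I rule: infinite_finite_induct)
  case (insert x I)
  then have "Poly_Mapping.keys (g x) \<subseteq> exps_below k" "Poly_Mapping.keys (\<Sum>i\<in>I. g i) \<subseteq> exps_below k"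
    by (simp_all flip: laurent_polys_keys)
  then have "Poly_Mapping.keys (g x + (\<Sum>i\<in>I. g i)) \<subseteq> exps_below k"
    using Poly_Mapping.keys_add[of "g x" "\<Sum>i\<in>I. g i"] by blast
  then show ?case
    using insert.hyps by (simp add: laurent_polys_keys)
qed (simp_all add: laurent_polys_def)

lemma laurent_polys_single: "e \<in> exps_below k \<Longrightarrow> Poly_Mapping.single e c \<in> laurent_polys k"
  by (auto simp: laurent_polys_def)

lemma laurent_eval_single_chi: "laurent_eval (Poly_Mapping.single e c) z = c * chi e z"
  by (simp add: laurent_eval_single chi_def)

lemma laurent_eval_sum_chi:
  "laurent_eval G z = (\<Sum>e\<in>Poly_Mapping.keys G. Poly_Mapping.lookup G e * chi e z)"
  by (simp add: laurent_eval_def chi_def)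

lemma laurent_eval_mult_ex:
  assumes "G \<in> laurent_polys k" "H \<in> laurent_polys k"
  shows "\<exists>P\<in>laurent_polys k. \<forall>z. (\<forall>j<k. norm (z j) = 1) \<longrightarrow>
    laurent_eval P z = laurent_eval G z * laurent_eval H z"
proof (intro bexI allI impI)
  let ?P = "\<Sum>b\<in>Poly_Mapping.keys G. \<Sum>b'\<in>Poly_Mapping.keys H.
    Poly_Mapping.single (b + b') (Poly_Mapping.lookup G b * Poly_Mapping.lookup H b')"
  have GH: "Poly_Mapping.keys G \<subseteq> exps_below k" "Poly_Mapping.keys H \<subseteq> exps_below k"
    using assms by (simp_all only: laurent_polys_keys)
  show "?P \<in> laurent_polys k"
    by (intro laurent_polys_sum laurent_polys_single exps_below_add subsetD[OF GH(1)] subsetD[OF GH(2)])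
  fix z :: "nat \<Rightarrow> complex" assume z: "\<forall>j<k. norm (z j) = 1"
  have "laurent_eval ?P z = (\<Sum>b\<in>Poly_Mapping.keys G. \<Sum>b'\<in>Poly_Mapping.keys H.
      (Poly_Mapping.lookup G b * chi b z) * (Poly_Mapping.lookup H b' * chi b' z))"
    unfolding laurent_eval_sum laurent_eval_single_chi
    by (intro sum.cong refl) (subst chi_add[OF subsetD[OF GH(1)] subsetD[OF GH(2)]], use z in auto)
  then show "laurent_eval ?P z = laurent_eval G z * laurent_eval H z"
    by (simp add: laurent_eval_sum_chi sum_product)
qed

text \<open>On the torus conjugating a monomial inverts it, so negative exponents absorb the
  conjugation.\<close>

lemma laurent_eval_cnj_ex:
  assumes "G \<in> laurent_polys k"
  shows "\<exists>P\<in>laurent_polys k. \<forall>z. (\<forall>j<k. norm (z j) = 1) \<longrightarrow> laurent_eval P z = cnj (laurent_eval G z)"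
proof (intro bexI allI impI)
  let ?P = "\<Sum>b\<in>Poly_Mapping.keys G. Poly_Mapping.single (- b) (cnj (Poly_Mapping.lookup G b))"
  have G: "Poly_Mapping.keys G \<subseteq> exps_below k"
    using assms by (simp only: laurent_polys_keys)
  show "?P \<in> laurent_polys k"
    by (intro laurent_polys_sum laurent_polys_single exps_below_uminus subsetD[OF G])
  fix z :: "nat \<Rightarrow> complex" assume z: "\<forall>j<k. norm (z j) = 1"
  have "chi (- b) z = cnj (chi b z)" if "b \<in> Poly_Mapping.keys G" for b
  proof -
    have "norm (chi b z) = 1"
      using G that z by (intro norm_chi[of b k]) auto
    then show ?thesis
      by (simp add: chi_uminus inverse_eq_divide complex_div_cnj[of 1])
  qed
  then show "laurent_eval ?P z = cnj (laurent_eval G z)"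
    by (simp add: laurent_eval_sum laurent_eval_single_chi laurent_eval_sum_chi[of G])
qed

text \<open>The squared modulus equals F times its conjugate, which is a Laurent polynomial on the
  torus, whereas the modulus itself need not be one. Closure under sums and products gives the
  rest.\<close>

lemma laurent_eval_real_polynomial_ex:
  assumes F: "F \<in> laurent_polys k" and g: "real_polynomial_function g"
  shows "\<exists>P\<in>laurent_polys k. \<forall>z. (\<forall>j<k. norm (z j) = 1) \<longrightarrow>
    laurent_eval P z = of_real (g ((norm (laurent_eval F z))\<^sup>2))"
  using g
proof (induction rule: real_polynomial_function.induct)
  case (linear f)
  obtain P where P: "P \<in> laurent_polys k"
    "\<And>z. (\<forall>j<k. norm (z j) = 1) \<Longrightarrow> laurent_eval P z = cnj (laurent_eval F z)"
    using laurent_eval_cnj_ex[OF F] by blast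
  obtain R where R: "R \<in> laurent_polys k"
    "\<And>z. (\<forall>j<k. norm (z j) = 1) \<Longrightarrow> laurent_eval R z = laurent_eval F z * laurent_eval P z"
    using laurent_eval_mult_ex[OF F P(1)] by blast
  have C: "Poly_Mapping.single 0 (of_real (f 1)) \<in> laurent_polys k"
    by (simp add: laurent_polys_single)
  obtain T where T: "T \<in> laurent_polys k"
    "\<And>z. (\<forall>j<k. norm (z j) = 1) \<Longrightarrow>
       laurent_eval T z = laurent_eval (Poly_Mapping.single 0 (of_real (f 1))) z * laurent_eval R z"
    using laurent_eval_mult_ex[OF C R(1)] by blast
  have f: "f x = f 1 * x" for x
    using linear_scale[OF bounded_linear.linear[OF linear], of x 1] by simp
  have "laurent_eval T z = of_real (f ((norm (laurent_eval F z))\<^sup>2))" if "\<forall>j<k. norm (z j) = 1" for z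
    unfolding f[of "(norm (laurent_eval F z))\<^sup>2"]
    using that by (simp only: T R P laurent_eval_single_chi chi_0 mult_1_right of_real_mult complex_norm_square)
  then show ?case
    using T(1) by blast
next
  case (const c)
  show ?case
    by (rule bexI[of _ "Poly_Mapping.single 0 (of_real c)"])
       (simp_all add: laurent_eval_single_chi laurent_polys_single)
next
  case (add f g)
  then obtain P R where P: "P \<in> laurent_polys k" "R \<in> laurent_polys k"
    "\<And>z. (\<forall>j<k. norm (z j) = 1) \<Longrightarrow> laurent_eval P z = of_real (f ((norm (laurent_eval F z))\<^sup>2))"
    "\<And>z. (\<forall>j<k. norm (z j) = 1) \<Longrightarrow> laurent_eval R z = of_real (g ((norm (laurent_eval F z))\<^sup>2))"
    by blast
  have "P + R \<in> laurent_polys k"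
    using laurent_polys_sum[of "UNIV :: bool set" "\<lambda>b. if b then P else R" k] P(1,2)
    by (simp add: UNIV_bool add.commute)
  with P(3,4) show ?case
    by (intro bexI[of _ "P + R"]) (simp_all add: laurent_eval_add)
next
  case (mult f g)
  then obtain P R where P: "P \<in> laurent_polys k" "R \<in> laurent_polys k"
    "\<And>z. (\<forall>j<k. norm (z j) = 1) \<Longrightarrow> laurent_eval P z = of_real (f ((norm (laurent_eval F z))\<^sup>2))"
    "\<And>z. (\<forall>j<k. norm (z j) = 1) \<Longrightarrow> laurent_eval R z = of_real (g ((norm (laurent_eval F z))\<^sup>2))"
    by blast
  from laurent_eval_mult_ex[OF P(1,2)] P(3,4) show ?case
    by simp
qed

text \<open>Truncation makes the logarithm a continuous function of the squared modulus on a compact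
  interval, so the Weierstrass theorem in one variable is enough.\<close>

lemma ln_max_norm_approx:
  assumes F: "F \<in> laurent_polys k" and \<eta>: "0 < \<eta>" and \<epsilon>: "0 < \<epsilon>"
  shows "\<exists>H\<in>laurent_polys k. \<forall>z. (\<forall>j<k. norm (z j) = 1) \<longrightarrow>
    norm (of_real (ln (max (norm (laurent_eval F z)) \<eta>)) - laurent_eval H z) \<le> \<epsilon>"
proof -
  define L where "L = (\<Sum>e\<in>Poly_Mapping.keys F. norm (Poly_Mapping.lookup F e))"
  have keys: "Poly_Mapping.keys F \<subseteq> exps_below k"
    using F by (simp only: laurent_polys_keys)
  have "continuous_on {0..L\<^sup>2} (\<lambda>u. ln (max (sqrt u) \<eta>))"
    using \<eta> by (intro continuous_intros) (auto simp: max_def)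
  then obtain g where g: "real_polynomial_function g"
    "\<And>u. u \<in> {0..L\<^sup>2} \<Longrightarrow> \<bar>ln (max (sqrt u) \<eta>) - g u\<bar> < \<epsilon>"
    using Stone_Weierstrass_real_polynomial_function[of "{0..L\<^sup>2}", OF _ _ \<epsilon>] by (metis compact_Icc)
  obtain H where H: "H \<in> laurent_polys k"
    "\<And>z. (\<forall>j<k. norm (z j) = 1) \<Longrightarrow> laurent_eval H z = of_real (g ((norm (laurent_eval F z))\<^sup>2))"
    using laurent_eval_real_polynomial_ex[OF F g(1)] by blast
  have "norm (of_real (ln (max (norm (laurent_eval F z)) \<eta>)) - laurent_eval H z) \<le> \<epsilon>"
    if z: "\<forall>j<k. norm (z j) = 1" for z
  proof -
    have "norm (laurent_eval F z) \<le> L"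
      unfolding laurent_eval_sum_chi L_def
      using norm_chi[OF subsetD[OF keys], of _ z] z
      by (intro order_trans[OF norm_sum] sum_mono) (auto simp: norm_mult)
    then have "(norm (laurent_eval F z))\<^sup>2 \<in> {0..L\<^sup>2}"
      by (auto intro: power_mono)
    from g(2)[OF this]
    have "\<bar>ln (max (norm (laurent_eval F z)) \<eta>) - g ((norm (laurent_eval F z))\<^sup>2)\<bar> \<le> \<epsilon>"
      by simp
    then show ?thesis
      by (simp only: H(2)[OF z] of_real_diff[symmetric] norm_of_real)
  qed
  then show ?thesis
    using H(1) by blast
qed

text \<open>The vectors span a rational space of dimension at most \<open>k\<close>, so finitely
  many of them impose all the linear conditions. The induction eliminates the last coordinate and
  thereby changes the vectors, hence the arbitrary \<open>v\<close>.\<close>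

lemma annihilator_finite_subset:
  fixes v :: "'a \<Rightarrow> nat \<Rightarrow> int"
  shows "\<exists>B\<subseteq>\<Lambda>. finite B \<and>
    (\<forall>a. (\<forall>b\<in>B. (\<Sum>j<k. a j * v b j) = 0) \<longrightarrow> (\<forall>b\<in>\<Lambda>. (\<Sum>j<k. a j * v b j) = 0))"
proof (induction k arbitrary: v)
  case 0
  show ?case by (intro exI[of _ "{}"]) simp
next
  case (Suc k)
  show ?case
  proof (cases "\<forall>b\<in>\<Lambda>. v b k = 0")
    case True
    obtain B where B: "B \<subseteq> \<Lambda>" "finite B"
      "\<And>a. (\<forall>b\<in>B. (\<Sum>j<k. a j * v b j) = 0) \<Longrightarrow> (\<forall>b\<in>\<Lambda>. (\<Sum>j<k. a j * v b j) = 0)"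
      using Suc.IH[of v] by blast
    have eq: "(\<Sum>j<Suc k. a j * v b j) = (\<Sum>j<k. a j * v b j)" if "b \<in> \<Lambda>" for a b
      using True that by simp
    have "\<forall>b\<in>\<Lambda>. (\<Sum>j<Suc k. a j * v b j) = 0" if "\<forall>b\<in>B. (\<Sum>j<Suc k. a j * v b j) = 0" for a
      using B(3)[of a] B(1) that eq by (metis subsetD)
    with B(1,2) show ?thesis by blast
  next
    case False
    then obtain b0 where b0: "b0 \<in> \<Lambda>" "v b0 k \<noteq> 0" by blast
    \<comment> \<open>Elimination without division, with pivot \<open>b0\<close>: the coordinate
      \<open>k\<close> of \<open>w b\<close> is zero.\<close>
    define w where "w b j = v b0 k * v b j - v b k * v b0 j" for b j
    obtain B where B: "B \<subseteq> \<Lambda>" "finite B"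
      "\<And>a. (\<forall>b\<in>B. (\<Sum>j<k. a j * w b j) = 0) \<Longrightarrow> (\<forall>b\<in>\<Lambda>. (\<Sum>j<k. a j * w b j) = 0)"
      using Suc.IH[of w] by blast
    have w: "(\<Sum>j<k. a j * w b j) =
        v b0 k * (\<Sum>j<Suc k. a j * v b j) - v b k * (\<Sum>j<Suc k. a j * v b0 j)" for a b
      by (simp add: w_def sum_distrib_left sum_subtractf algebra_simps)
    have "\<forall>b\<in>\<Lambda>. (\<Sum>j<Suc k. a j * v b j) = 0"
      if a: "\<forall>b\<in>insert b0 B. (\<Sum>j<Suc k. a j * v b j) = 0" for a
    proof -
      have "\<forall>b\<in>B. (\<Sum>j<k. a j * w b j) = 0"
        unfolding w using a by simp
      from B(3)[OF this] have "\<forall>b\<in>\<Lambda>. v b0 k * (\<Sum>j<Suc k. a j * v b j) = 0"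
        unfolding w using a by simp
      then show ?thesis using b0 by simp
    qed
    moreover have "insert b0 B \<subseteq> \<Lambda>" "finite (insert b0 B)"
      using B(1,2) b0 by simp_all
    ultimately show ?thesis
      by blast
  qed
qed

text \<open>These are the exponents of the monomials that the substitution turns into 1.\<close>

definition exponent_kernel :: "nat \<Rightarrow> nat \<Rightarrow> (nat \<Rightarrow> nat \<Rightarrow> int) \<Rightarrow> (nat \<Rightarrow>\<^sub>0 int) set" where
  "exponent_kernel l k A = {b. exponent_map l k A b = 0}"

lemma exponent_kernel_iff:
  "b \<in> exponent_kernel l k A \<longleftrightarrow> (\<forall>i<l. (\<Sum>j<k. A i j * Poly_Mapping.lookup b j) = 0)"
  by (auto simp: exponent_kernel_def poly_mapping_eq_iff fun_eq_iff lookup_exponent_map)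

text \<open>The kernels are the annihilators of the rows, so by the previous lemma a union of a chain of
  sets contained in kernels is controlled by a single member of the chain, and Zorn's lemma
  applies.\<close>

lemma generic_kernel:
  fixes Q :: "real \<Rightarrow> nat \<Rightarrow> (nat \<Rightarrow> nat \<Rightarrow> int) \<Rightarrow> bool"
  assumes ex: "\<And>\<epsilon>. 0 < \<epsilon> \<Longrightarrow> \<exists>l A. Q \<epsilon> l A"
    and mono: "\<And>\<epsilon> \<epsilon>' l A. Q \<epsilon> l A \<Longrightarrow> \<epsilon> \<le> \<epsilon>' \<Longrightarrow> Q \<epsilon>' l A"
  shows "\<exists>\<Lambda>. \<forall>\<epsilon> S. 0 < \<epsilon> \<longrightarrow> finite S \<longrightarrow>
    (\<exists>l A. Q \<epsilon> l A \<and> \<Lambda> \<subseteq> exponent_kernel l k A \<and> exponent_kernel l k A \<inter> S \<subseteq> \<Lambda>)"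
proof -
  define P where "P = {\<Lambda>. \<forall>\<epsilon>>0. \<exists>l A. Q \<epsilon> l A \<and> \<Lambda> \<subseteq> exponent_kernel l k A}"
  have "\<exists>\<Lambda>\<in>P. \<forall>X\<in>P. \<Lambda> \<subseteq> X \<longrightarrow> X = \<Lambda>"
  proof (rule subset_Zorn')
    fix C assume C: "subset.chain P C"
    show "\<Union>C \<in> P"
    proof (cases "C = {}")
      case True
      then show ?thesis using ex by (auto simp: P_def)
    next
      case False
      obtain B where B: "B \<subseteq> \<Union>C" "finite B" "\<And>a :: nat \<Rightarrow> int.
          (\<forall>b\<in>B. (\<Sum>j<k. a j * Poly_Mapping.lookup b j) = 0) \<Longrightarrow>
          (\<forall>b\<in>\<Union>C. (\<Sum>j<k. a j * Poly_Mapping.lookup b j) = 0)"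
        using annihilator_finite_subset[where \<Lambda> = "\<Union>C" and k = k and v = Poly_Mapping.lookup] by blast
      obtain \<Lambda> where \<Lambda>: "\<Lambda> \<in> C" "B \<subseteq> \<Lambda>"
        using finite_subset_Union_chain[OF B(2,1) False] C by (auto simp: subset_chain_def)
      have "\<Union>C \<subseteq> exponent_kernel l k A" if "\<Lambda> \<subseteq> exponent_kernel l k A" for l A
      proof
        fix b assume b: "b \<in> \<Union>C"
        have "(\<Sum>j<k. A i j * Poly_Mapping.lookup b j) = 0" if "i < l" for i
        proof -
          have "\<forall>b\<in>B. (\<Sum>j<k. A i j * Poly_Mapping.lookup b j) = 0"
            using \<Lambda>(2) \<open>\<Lambda> \<subseteq> exponent_kernel l k A\<close> that by (auto simp: subset_iff exponent_kernel_iff)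
          from B(3)[OF this] b show ?thesis by blast
        qed
        then show "b \<in> exponent_kernel l k A"
          by (simp add: exponent_kernel_iff)
      qed
      moreover have "\<Lambda> \<in> P"
        using C \<Lambda>(1) by (auto simp: subset_chain_def)
      ultimately show ?thesis
        unfolding P_def by blast
    qed
  qed
  then obtain \<Lambda> where \<Lambda>: "\<Lambda> \<in> P" and max: "\<And>X. X \<in> P \<Longrightarrow> \<Lambda> \<subseteq> X \<Longrightarrow> X = \<Lambda>"
    by blast
  have "\<exists>l A. Q \<epsilon> l A \<and> \<Lambda> \<subseteq> exponent_kernel l k A \<and> exponent_kernel l k A \<inter> S \<subseteq> \<Lambda>"
    if \<epsilon>: "0 < \<epsilon>" and S: "finite S" for \<epsilon> S
  proof -
    \<comment> \<open>By maximality each \<open>b\<close> outside \<open>\<Lambda>\<close> is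
      excluded below some scale; the finitely many such \<open>b\<close> in \<open>S\<close> have a
      common scale.\<close>
    have "\<exists>e>0. \<forall>l A. Q e l A \<longrightarrow> \<not> insert b \<Lambda> \<subseteq> exponent_kernel l k A" if "b \<in> S - \<Lambda>" for b
    proof -
      have "insert b \<Lambda> \<notin> P"
        using max[of "insert b \<Lambda>"] that by blast
      then show ?thesis by (auto simp: P_def)
    qed
    then obtain e where e: "\<And>b. b \<in> S - \<Lambda> \<Longrightarrow> 0 < e b"
        "\<And>b l A. b \<in> S - \<Lambda> \<Longrightarrow> Q (e b) l A \<Longrightarrow> \<not> insert b \<Lambda> \<subseteq> exponent_kernel l k A"
      by metis
    define \<epsilon>' where "\<epsilon>' = Min (insert \<epsilon> (e ` (S - \<Lambda>)))"
    have "0 < \<epsilon>'"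
      using S \<epsilon> e(1) by (simp add: \<epsilon>'_def)
    then obtain l A where lA: "Q \<epsilon>' l A" "\<Lambda> \<subseteq> exponent_kernel l k A"
      using \<Lambda> by (auto simp: P_def)
    have "Q \<epsilon> l A"
      using S by (intro mono[OF lA(1)]) (simp add: \<epsilon>'_def)
    moreover have "b \<in> \<Lambda>" if "b \<in> exponent_kernel l k A" "b \<in> S" for b
    proof (rule ccontr)
      assume "b \<notin> \<Lambda>"
      then have b: "b \<in> S - \<Lambda>" using that by simp
      have "Q (e b) l A"
        using S b by (intro mono[OF lA(1)]) (simp add: \<epsilon>'_def)
      from e(2)[OF b this] lA(2) that(1) show False by simp
    qed
    ultimately show ?thesis
      using lA(2) by blast
  qed
  then show ?thesis by blast
qed

subsection \<open>Isolation of 0\<close>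

lemma ln_max_lipschitz:
  fixes a b \<eta> :: real
  assumes "0 < \<eta>"
  shows "ln (max a \<eta>) - ln (max b \<eta>) \<le> \<bar>a - b\<bar> / \<eta>"
proof -
  have pos: "0 < max a \<eta>" "0 < max b \<eta>"
    using assms by (auto simp: less_max_iff_disj)
  have "ln (max a \<eta>) - ln (max b \<eta>) \<le> (max a \<eta> - max b \<eta>) / max b \<eta>"
    using pos by (rule ln_diff_le)
  also have "\<dots> \<le> \<bar>a - b\<bar> / max b \<eta>"
    using pos by (intro divide_right_mono) (auto simp: max_def)
  also have "\<dots> \<le> \<bar>a - b\<bar> / \<eta>"
    using assms by (intro divide_left_mono) (auto simp: less_max_iff_disj)
  finally show ?thesis .
qed

section \<open>Terms and coefficients after a monomial substitution\<close>

lemma exponent_map_in_exps_below: "exponent_map l k A e \<in> exps_below l"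
  using keys_exponent_map by simp

lemma exponent_map_diff: "exponent_map l k A (e - f) = exponent_map l k A e - exponent_map l k A f"
  by (rule poly_mapping_eqI)
     (simp add: lookup_minus lookup_exponent_map right_diff_distrib sum_subtractf)

lemma lookup_monomial_subst:
  "Poly_Mapping.lookup (monomial_subst l k A F) f =
    (\<Sum>e\<in>{e \<in> Poly_Mapping.keys F. exponent_map l k A e = f}. Poly_Mapping.lookup F e)"
proof -
  have "Poly_Mapping.lookup (monomial_subst l k A F) f =
      (\<Sum>e\<in>Poly_Mapping.keys F. if exponent_map l k A e = f then Poly_Mapping.lookup F e else 0)"
    by (simp add: monomial_subst_def lookup_sum lookup_single when_def)
  then show ?thesis
    by (simp add: sum.If_cases Int_def)
qed

lemma keys_monomial_subst:
  "Poly_Mapping.keys (monomial_subst l k A F) \<subseteq> exponent_map l k A ` Poly_Mapping.keys F"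
proof
  fix f assume "f \<in> Poly_Mapping.keys (monomial_subst l k A F)"
  then have "Poly_Mapping.lookup (monomial_subst l k A F) f \<noteq> 0"
    by (simp add: in_keys_iff)
  then have "{e \<in> Poly_Mapping.keys F. exponent_map l k A e = f} \<noteq> {}"
    unfolding lookup_monomial_subst by (metis sum.empty)
  then show "f \<in> exponent_map l k A ` Poly_Mapping.keys F"
    by auto
qed

lemma keys_monomial_subst_exps_below:
  "Poly_Mapping.keys (monomial_subst l k A F) \<subseteq> exps_below l"
  using keys_monomial_subst exponent_map_in_exps_below by fastforce

lemma card_keys_monomial_subst:
  "card (Poly_Mapping.keys (monomial_subst l k A F)) \<le> card (Poly_Mapping.keys F)"
  by (rule order_trans[OF card_mono[OF _ keys_monomial_subst] card_image_le]) auto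

text \<open>Integrality enters here: merged coefficients are sums of integers, so those that do not
  vanish have modulus at least 1, the normalisation behind all the uniform bounds.\<close>

lemma norm_lookup_monomial_subst_ge_1:
  assumes "\<And>e. Poly_Mapping.lookup F e \<in> \<int>"
    and "f \<in> Poly_Mapping.keys (monomial_subst l k A F)"
  shows "1 \<le> norm (Poly_Mapping.lookup (monomial_subst l k A F) f)"
proof -
  have "Poly_Mapping.lookup (monomial_subst l k A F) f \<in> \<int>"
    unfolding lookup_monomial_subst by (intro Ints_sum assms(1))
  then obtain n where n: "Poly_Mapping.lookup (monomial_subst l k A F) f = of_int n"
    by (auto elim: Ints_cases)
  moreover have "n \<noteq> 0"
    using assms(2) n by (auto simp: in_keys_iff)
  ultimately show ?thesis
    by simp
qed

text \<open>The sum runs over the unmerged terms of F because the two substitutions may merge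
  different terms; \<open>two_point_eval_eq\<close> identifies it with F at a product of two
  monomial points.\<close>

definition two_point_eval ::
  "nat \<Rightarrow> (nat \<Rightarrow> nat \<Rightarrow> int) \<Rightarrow> nat \<Rightarrow> (nat \<Rightarrow> nat \<Rightarrow> int) \<Rightarrow> nat \<Rightarrow> complex laurent \<Rightarrow>
    (nat \<Rightarrow> complex) \<Rightarrow> (nat \<Rightarrow> complex) \<Rightarrow> complex" where
  "two_point_eval l' A' l A k F y x = (\<Sum>e\<in>Poly_Mapping.keys F. Poly_Mapping.lookup F e *
     chi (exponent_map l' k A' e) y * chi (exponent_map l k A e) x)"

lemma chi_exponent_map:
  assumes "e \<in> exps_below k" "\<And>i. i < l \<Longrightarrow> norm (x i) = 1"
  shows "chi (exponent_map l k A e) x = chi e (\<lambda>j. \<Prod>i<l. x i powi A i j)"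
proof -
  have "laurent_eval (monomial_subst l k A (Poly_Mapping.single e 1)) x =
      laurent_eval (Poly_Mapping.single e 1) (\<lambda>j. \<Prod>i<l. x i powi A i j)"
    using assms by (intro laurent_eval_monomial_subst laurent_polys_single) force+
  then show ?thesis
    by (simp add: monomial_subst_def laurent_eval_single_chi)
qed

lemma two_point_eval_eq:
  assumes F: "F \<in> laurent_polys k"
    and y: "y \<in> space (torus l')" and x: "x \<in> space (torus l)"
  shows "two_point_eval l' A' l A k F y x =
    laurent_eval F (\<lambda>j. (\<Prod>i<l'. y i powi A' i j) * (\<Prod>i<l. x i powi A i j))"
  unfolding two_point_eval_def laurent_eval_sum_chi
proof (rule sum.cong[OF refl])
  fix e assume "e \<in> Poly_Mapping.keys F"
  then have e: "e \<in> exps_below k"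
    using F by (auto simp: laurent_polys_def)
  have "chi (exponent_map l' k A' e) y = chi e (\<lambda>j. \<Prod>i<l'. y i powi A' i j)"
    "chi (exponent_map l k A e) x = chi e (\<lambda>j. \<Prod>i<l. x i powi A i j)"
    by (intro chi_exponent_map e norm_torus[OF y] norm_torus[OF x]; assumption)+
  then show "Poly_Mapping.lookup F e * chi (exponent_map l' k A' e) y * chi (exponent_map l k A e) x =
      Poly_Mapping.lookup F e * chi e (\<lambda>j. (\<Prod>i<l'. y i powi A' i j) * (\<Prod>i<l. x i powi A i j))"
    by (simp add: chi_eq_prod[OF e] power_int_mult_distrib prod.distrib)
qed

lemma norm_monomial_point:
  assumes "y \<in> space (torus l')" "x \<in> space (torus l)"
  shows "norm ((\<Prod>i<l'. y i powi A' i j) * (\<Prod>i<l. x i powi A i j)) = 1"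
  using norm_torus[OF assms(1)] norm_torus[OF assms(2)]
  by (simp add: norm_mult prod_norm[symmetric] norm_power_int)

lemma norm_two_point_eval_le:
  assumes "y \<in> space (torus l')" "x \<in> space (torus l)"
  shows "norm (two_point_eval l' A' l A k F y x) \<le>
    (\<Sum>e\<in>Poly_Mapping.keys F. norm (Poly_Mapping.lookup F e))"
  unfolding two_point_eval_def
  using norm_chi_torus[OF exponent_map_in_exps_below assms(1)]
    norm_chi_torus[OF exponent_map_in_exps_below assms(2)]
  by (intro order_trans[OF norm_sum] sum_mono) (simp add: norm_mult)

lemma two_point_eval_measurable:
  "case_prod (two_point_eval l' A' l A k F) \<in> borel_measurable (torus l' \<Otimes>\<^sub>M torus l)"
  unfolding two_point_eval_def case_prod_beta
  by (intro borel_measurable_sum borel_measurable_times borel_measurable_const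
      measurable_compose[OF measurable_fst chi_measurable[OF exponent_map_in_exps_below]]
      measurable_compose[OF measurable_snd chi_measurable[OF exponent_map_in_exps_below]])

lemma two_point_eval_measurable_fst:
  "(\<lambda>y. two_point_eval l' A' l A k F y x) \<in> borel_measurable (torus l')"
  unfolding two_point_eval_def
  by (intro borel_measurable_sum borel_measurable_times borel_measurable_const
      chi_measurable[OF exponent_map_in_exps_below])

lemma chi_ones: "(\<And>i. i < l \<Longrightarrow> x i = 1) \<Longrightarrow> e \<in> exps_below l \<Longrightarrow> chi e x = 1"
  by (simp add: chi_eq_prod)

lemma laurent_eval_monomial_subst_sum:
  "laurent_eval (monomial_subst l k A F) x =
    (\<Sum>e\<in>Poly_Mapping.keys F. Poly_Mapping.lookup F e * chi (exponent_map l k A e) x)"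
  by (simp add: monomial_subst_def laurent_eval_sum laurent_eval_single_chi)

text \<open>Terms merged by \<open>A\<close> are merged by \<open>A'\<close> as well, so they carry
  the same factor in \<open>y\<close>. It can be pulled out of the merged coefficient, and terms
  that cancel in F_A cancel for every \<open>y\<close>.\<close>

lemma two_point_eval_twist:
  assumes compat: "\<And>e e'. e \<in> Poly_Mapping.keys F \<Longrightarrow> e' \<in> Poly_Mapping.keys F \<Longrightarrow>
      exponent_map l k A e = exponent_map l k A e' \<Longrightarrow>
      exponent_map l' k A' e = exponent_map l' k A' e'"
    and y: "y \<in> space (torus l')"
  obtains u where "\<And>f. f \<in> Poly_Mapping.keys (monomial_subst l k A F) \<Longrightarrow> norm (u f) = 1"
    "\<And>x. two_point_eval l' A' l A k F y x =
       trig_poly (Poly_Mapping.keys (monomial_subst l k A F))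
         (\<lambda>f. Poly_Mapping.lookup (monomial_subst l k A F) f * u f) x"
proof -
  let ?K = "Poly_Mapping.keys F" and ?G = "monomial_subst l k A F" and ?a = "exponent_map l k A"
  \<comment> \<open>Any representative of the merged terms will do, by
    \<open>compat\<close>.\<close>
  define r where "r f = (SOME e. e \<in> ?K \<and> ?a e = f)" for f
  have r: "r (?a e) \<in> ?K" "?a (r (?a e)) = ?a e" if "e \<in> ?K" for e
    using someI[of "\<lambda>e'. e' \<in> ?K \<and> ?a e' = ?a e" e] that by (auto simp: r_def)
  define u where "u f = chi (exponent_map l' k A' (r f)) y" for f
  have u: "chi (exponent_map l' k A' e) y = u (?a e)" if "e \<in> ?K" for e
    using compat[OF r(1)[OF that] that r(2)[OF that]] by (simp add: u_def)
  show thesis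
  proof (rule that[of u])
    show "norm (u f) = 1" for f
      unfolding u_def by (rule norm_chi_torus[OF exponent_map_in_exps_below y])
    fix x
    have "two_point_eval l' A' l A k F y x =
        (\<Sum>e\<in>?K. Poly_Mapping.lookup F e * u (?a e) * chi (?a e) x)"
      by (simp add: two_point_eval_def u)
    also have "\<dots> = (\<Sum>f\<in>?a ` ?K. \<Sum>e\<in>{e \<in> ?K. ?a e = f}. Poly_Mapping.lookup F e * u (?a e) * chi (?a e) x)"
      by (rule sum.image_gen) simp
    also have "\<dots> = (\<Sum>f\<in>?a ` ?K. Poly_Mapping.lookup ?G f * u f * chi f x)"
      by (intro sum.cong refl) (simp add: lookup_monomial_subst sum_distrib_right)
    also have "\<dots> = (\<Sum>f\<in>Poly_Mapping.keys ?G. Poly_Mapping.lookup ?G f * u f * chi f x)"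
      by (intro sum.mono_neutral_right keys_monomial_subst) (auto simp: in_keys_iff)
    finally show "two_point_eval l' A' l A k F y x =
        trig_poly (Poly_Mapping.keys ?G) (\<lambda>f. Poly_Mapping.lookup ?G f * u f) x"
      by (simp add: trig_poly_def)
  qed
qed

text \<open>If \<open>H\<close> approximates \<open>ln (max \<bar>F\<bar> \<eta>)\<close>, then the integral over \<open>y\<close> only sees those
  exponents of \<open>H\<close> that \<open>A'\<close> annihilates. When \<open>A\<close> annihilates them too, the result does not
  depend on \<open>x\<close>.\<close>

lemma integral_two_point_eval_indep:
  assumes F: "F \<in> laurent_polys k" and \<eta>: "0 < \<eta>"
    and H: "H \<in> laurent_polys k" "\<And>z. (\<forall>j<k. norm (z j) = 1) \<Longrightarrow>
      norm (of_real (ln (max (norm (laurent_eval F z)) \<eta>)) - laurent_eval H z) \<le> \<epsilon>"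
    and ker: "exponent_kernel l' k A' \<inter> Poly_Mapping.keys H \<subseteq> exponent_kernel l k A"
    and x: "x \<in> space (torus l)" "x' \<in> space (torus l)"
  shows "(\<integral>y. ln (max (norm (two_point_eval l' A' l A k F y x)) \<eta>) \<partial>torus l') \<le>
    (\<integral>y. ln (max (norm (two_point_eval l' A' l A k F y x')) \<eta>) \<partial>torus l') + 2 * \<epsilon>"
proof -
  \<comment> \<open>This turns out to be the mean over \<open>y\<close> of the approximation
    \<open>H\<close>, the same for every \<open>x\<close>. Comparing both means with it costs
    \<open>\<epsilon>\<close> each.\<close>
  define c where "c = (\<Sum>b\<in>Poly_Mapping.keys H. if b \<in> exponent_kernel l' k A' then Poly_Mapping.lookup H b else 0)"
  have near: "norm (of_real (\<integral>y. ln (max (norm (two_point_eval l' A' l A k F y x)) \<eta>) \<partial>torus l') - c) \<le> \<epsilon>"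
    if x: "x \<in> space (torus l)" for x
  proof -
    let ?g = "\<lambda>y. complex_of_real (ln (max (norm (two_point_eval l' A' l A k F y x)) \<eta>))"
    let ?h = "\<lambda>y. two_point_eval l' A' l A k H y x"
    have int_g: "integrable (torus l') ?g"
      by (intro integrable_of_real integrable_ln_max_norm[OF \<eta> two_point_eval_measurable_fst
            torus.prob_space_axioms norm_two_point_eval_le] x)
    have int_b: "integrable (torus l') (\<lambda>y. Poly_Mapping.lookup H b *
        chi (exponent_map l' k A' b) y * chi (exponent_map l k A b) x)" for b
      by (intro integrable_mult_left integrable_mult_right integrable_chi exponent_map_in_exps_below)
    have int_h: "integrable (torus l') ?h"
      unfolding two_point_eval_def by (intro Bochner_Integration.integrable_sum int_b)
    have "(\<integral>y. ?h y \<partial>torus l') = (\<Sum>b\<in>Poly_Mapping.keys H. Poly_Mapping.lookup H b *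
        (\<integral>y. chi (exponent_map l' k A' b) y \<partial>torus l') * chi (exponent_map l k A b) x)"
      unfolding two_point_eval_def using int_b
      by (subst Bochner_Integration.integral_sum) auto
    also have "\<dots> = c"
      unfolding c_def
    proof (rule sum.cong[OF refl])
      fix b assume b: "b \<in> Poly_Mapping.keys H"
      show "Poly_Mapping.lookup H b * (\<integral>y. chi (exponent_map l' k A' b) y \<partial>torus l') *
          chi (exponent_map l k A b) x = (if b \<in> exponent_kernel l' k A' then Poly_Mapping.lookup H b else 0)"
      proof (cases "b \<in> exponent_kernel l' k A'")
        case True
        then have "exponent_map l' k A' b = 0" "exponent_map l k A b = 0"
          using ker b by (auto simp: exponent_kernel_def)
        then show ?thesis
          using True by (simp add: torus.prob_space)
      next
        case False
        then have "(\<integral>y. chi (exponent_map l' k A' b) y \<partial>torus l') = 0"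
          by (intro integral_chi exponent_map_in_exps_below) (simp add: exponent_kernel_def)
        then show ?thesis using False by simp
      qed
    qed
    finally have int_eq: "(\<integral>y. ?h y \<partial>torus l') = c" .
    have "of_real (\<integral>y. ln (max (norm (two_point_eval l' A' l A k F y x)) \<eta>) \<partial>torus l') - c =
        (\<integral>y. ?g y \<partial>torus l') - (\<integral>y. ?h y \<partial>torus l')"
      by (simp only: int_eq integral_complex_of_real)
    also have "\<dots> = (\<integral>y. ?g y - ?h y \<partial>torus l')"
      by (rule Bochner_Integration.integral_diff[OF int_g int_h, symmetric])
    finally have eq: "of_real (\<integral>y. ln (max (norm (two_point_eval l' A' l A k F y x)) \<eta>) \<partial>torus l') - c =
        (\<integral>y. ?g y - ?h y \<partial>torus l')" .
    have "norm (\<integral>y. ?g y - ?h y \<partial>torus l') \<le> (\<integral>y. norm (?g y - ?h y) \<partial>torus l')"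
      by (rule integral_norm_bound)
    also have "\<dots> \<le> \<epsilon>"
    proof (rule torus.integral_le_const)
      show "integrable (torus l') (\<lambda>y. norm (?g y - ?h y))"
        by (intro integrable_norm Bochner_Integration.integrable_diff int_g int_h)
      show "AE y in torus l'. norm (?g y - ?h y) \<le> \<epsilon>"
      proof (rule AE_I2)
        fix y assume y: "y \<in> space (torus l')"
        show "norm (?g y - ?h y) \<le> \<epsilon>"
          unfolding two_point_eval_eq[OF F y x] two_point_eval_eq[OF H(1) y x]
          by (intro H(2)) (simp add: norm_monomial_point[OF y x])
      qed
    qed
    finally show ?thesis
      unfolding eq .
  qed
  have diff: "\<bar>a - b\<bar> \<le> 2 * \<epsilon>" if "norm (of_real a - c) \<le> \<epsilon>" "norm (of_real b - c) \<le> \<epsilon>" for a b :: real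
  proof -
    have "norm ((of_real a - c) - (of_real b - c)) \<le> \<epsilon> + \<epsilon>"
      by (rule order_trans[OF norm_triangle_ineq4 add_mono[OF that]])
    also have "(of_real a - c) - (of_real b - c) = of_real (a - b)"
      by simp
    finally show ?thesis
      by (simp only: norm_of_real mult_2)
  qed
  show ?thesis
    using diff[OF near[OF x(1)] near[OF x(2)]] by linarith
qed

section \<open>Contradiction between the two iterated means\<close>

theorem theorem2:
  fixes k :: nat and F :: "complex laurent"
  assumes "k \<ge> 1"
    and "F \<in> laurent_polys k"
    and "\<And>e. Poly_Mapping.lookup F e \<in> \<int>"
    and "F \<noteq> 0"
    and "0 \<in> mahler_set k F"
  shows "0 isolated_in mahler_set k F"
proof (rule ccontr)
  assume not_isolated: "\<not> 0 isolated_in mahler_set k F"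
  note F = \<open>F \<in> laurent_polys k\<close>
  define G where "G l A = monomial_subst l k A F" for l A
  define m where "m l A = mahler_measure l (G l A)" for l A
  define N where "N = card (Poly_Mapping.keys F)"
  define c where "c = Poly_Mapping.lookup F"
  have G_keys: "Poly_Mapping.keys (G l A) \<subseteq> exps_below l" "card (Poly_Mapping.keys (G l A)) \<le> N" for l A
    unfolding G_def N_def by (rule keys_monomial_subst_exps_below card_keys_monomial_subst)+
  have G_int: "1 \<le> norm (Poly_Mapping.lookup (G l A) f)" if "f \<in> Poly_Mapping.keys (G l A)" for l A f
    using that unfolding G_def by (intro norm_lookup_monomial_subst_ge_1 assms(3))
  have m_eq: "m l A = (\<integral>z. ln (norm (laurent_eval (G l A) z)) \<partial>torus l)" for l A
    unfolding m_def G_def by (rule mahler_measure_eq_integral_torus[OF monomial_subst_in_laurent_polys])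
  \<comment> \<open>One height serves all matrices and all unimodular twists \<open>u\<close>. The
    twists are needed because, for fixed \<open>y\<close>, the two-point function is such a twist of
    F_A.\<close>
  have trunc: "\<exists>\<eta>0>0. \<forall>\<eta> l A u. 0 < \<eta> \<longrightarrow> \<eta> \<le> \<eta>0 \<longrightarrow> G l A \<noteq> 0 \<longrightarrow>
      (\<forall>f\<in>Poly_Mapping.keys (G l A). norm (u f) = 1) \<longrightarrow>
      (let f = trig_poly (Poly_Mapping.keys (G l A)) (\<lambda>f. Poly_Mapping.lookup (G l A) f * u f) in
       (AE z in torus l. f z \<noteq> 0) \<and> integrable (torus l) (\<lambda>z. ln (norm (f z))) \<and>
       0 \<le> (\<integral>z. ln (max (norm (f z)) \<eta>) \<partial>torus l) \<and>
       (\<integral>z. ln (max (norm (f z)) \<eta>) \<partial>torus l) \<le> (\<integral>z. ln (norm (f z)) \<partial>torus l) + \<epsilon>)"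
    if \<epsilon>: "0 < \<epsilon>" for \<epsilon>
  proof -
    obtain \<eta>0 where \<eta>0: "0 < \<eta>0" "\<And>\<eta> l S c e0. 0 < \<eta> \<Longrightarrow> \<eta> \<le> \<eta>0 \<Longrightarrow> finite S \<Longrightarrow> card S \<le> N \<Longrightarrow>
       S \<subseteq> exps_below l \<Longrightarrow> e0 \<in> S \<Longrightarrow> 1 \<le> norm (c e0) \<Longrightarrow>
       (AE z in torus l. trig_poly S c z \<noteq> 0) \<and>
       integrable (torus l) (\<lambda>z. ln (norm (trig_poly S c z))) \<and>
       (\<integral>z. ln (max (norm (trig_poly S c z)) \<eta>) \<partial>torus l) \<le>
         (\<integral>z. ln (norm (trig_poly S c z)) \<partial>torus l) + \<epsilon>"
      using ln_trig_poly_truncation[OF \<epsilon>, of N] by metis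
    show ?thesis
      unfolding Let_def
    proof (intro exI[of _ \<eta>0] conjI[OF \<eta>0(1)] allI impI)
      fix \<eta> l A and u :: "(nat \<Rightarrow>\<^sub>0 int) \<Rightarrow> complex"
      assume *: "0 < \<eta>" "\<eta> \<le> \<eta>0" "G l A \<noteq> 0" "\<forall>f\<in>Poly_Mapping.keys (G l A). norm (u f) = 1"
      let ?S = "Poly_Mapping.keys (G l A)" and ?c = "\<lambda>f. Poly_Mapping.lookup (G l A) f * u f"
      have S: "finite ?S" "?S \<noteq> {}"
        using *(3) by auto
      have c: "1 \<le> norm (?c f)" if "f \<in> ?S" for f
        using G_int[OF that] *(4) that by (simp add: norm_mult)
      obtain e0 where e0: "e0 \<in> ?S"
        using S(2) by blast
      have "0 \<le> (\<integral>z. ln (max (norm (trig_poly ?S ?c z)) \<eta>) \<partial>torus l)"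
        by (rule integral_ln_max_trig_poly_nonneg[OF S G_keys(1) c *(1)])
      with \<eta>0(2)[OF *(1,2) S(1) G_keys(2,1) e0, of ?c, OF c[OF e0]]
      show "(AE z in torus l. trig_poly ?S ?c z \<noteq> 0) \<and>
        integrable (torus l) (\<lambda>z. ln (norm (trig_poly ?S ?c z))) \<and>
        0 \<le> (\<integral>z. ln (max (norm (trig_poly ?S ?c z)) \<eta>) \<partial>torus l) \<and>
        (\<integral>z. ln (max (norm (trig_poly ?S ?c z)) \<eta>) \<partial>torus l) \<le>
        (\<integral>z. ln (norm (trig_poly ?S ?c z)) \<partial>torus l) + \<epsilon>"
        by blast
    qed
  qed
  have trunc1: "\<exists>\<eta>0>0. \<forall>\<eta> l A. 0 < \<eta> \<longrightarrow> \<eta> \<le> \<eta>0 \<longrightarrow> G l A \<noteq> 0 \<longrightarrow>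
      (AE z in torus l. laurent_eval (G l A) z \<noteq> 0) \<and>
      integrable (torus l) (\<lambda>z. ln (norm (laurent_eval (G l A) z))) \<and>
      0 \<le> (\<integral>z. ln (max (norm (laurent_eval (G l A) z)) \<eta>) \<partial>torus l) \<and>
      (\<integral>z. ln (max (norm (laurent_eval (G l A) z)) \<eta>) \<partial>torus l) \<le> m l A + \<epsilon>"
    if \<epsilon>: "0 < \<epsilon>" for \<epsilon>
  proof -
    obtain \<eta>0 where "0 < \<eta>0" and \<eta>0: "\<And>\<eta> l A u. 0 < \<eta> \<Longrightarrow> \<eta> \<le> \<eta>0 \<Longrightarrow> G l A \<noteq> 0 \<Longrightarrow>
      (\<forall>f\<in>Poly_Mapping.keys (G l A). norm (u f) = 1) \<Longrightarrow>
      (let f = trig_poly (Poly_Mapping.keys (G l A)) (\<lambda>f. Poly_Mapping.lookup (G l A) f * u f) in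
       (AE z in torus l. f z \<noteq> 0) \<and> integrable (torus l) (\<lambda>z. ln (norm (f z))) \<and>
       0 \<le> (\<integral>z. ln (max (norm (f z)) \<eta>) \<partial>torus l) \<and>
       (\<integral>z. ln (max (norm (f z)) \<eta>) \<partial>torus l) \<le> (\<integral>z. ln (norm (f z)) \<partial>torus l) + \<epsilon>)"
      using trunc[OF \<epsilon>] by blast
    then show ?thesis
      using \<eta>0[where u = "\<lambda>_. 1"]
      by (intro exI[of _ \<eta>0]) (simp add: m_eq laurent_eval_eq_trig_poly Let_def)
  qed
  have m_nonneg: "0 \<le> m l A" if "G l A \<noteq> 0" for l A
  proof (rule field_le_epsilon)
    fix \<epsilon> :: real assume "0 < \<epsilon>"
    from trunc1[OF this] that show "0 \<le> m l A + \<epsilon>"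
      by (meson order_refl order_trans)
  qed
  define Q where "Q \<epsilon> l A \<longleftrightarrow> G l A \<noteq> 0 \<and> 0 < m l A \<and> m l A < \<epsilon>" for \<epsilon> l A
  have Q_mono: "Q \<epsilon> l A \<Longrightarrow> \<epsilon> \<le> \<epsilon>' \<Longrightarrow> Q \<epsilon>' l A" for \<epsilon> \<epsilon>' l A
    by (simp add: Q_def)
  have Q_ex: "\<exists>l A. Q \<epsilon> l A" if "0 < \<epsilon>" for \<epsilon>
  proof -
    \<comment> \<open>Since 0 belongs to the set, failure of isolation yields other values
      arbitrarily near 0; these are positive by \<open>m_nonneg\<close>.\<close>
    have "\<not> (\<exists>e>0. \<forall>v\<in>mahler_set k F. dist 0 v < e \<longrightarrow> v = 0)"
      using not_isolated assms(5) by (simp only: isolated_in_dist_Ex_iff simp_thms)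
    then obtain v where v: "v \<in> mahler_set k F" "dist 0 v < \<epsilon>" "v \<noteq> 0"
      using \<open>0 < \<epsilon>\<close> by blast
    then obtain l A where "v = m l A" "G l A \<noteq> 0"
      by (auto simp: mahler_set_def m_def G_def)
    then show ?thesis
      using v m_nonneg[of l A] by (auto simp: Q_def dist_real_def intro!: exI[of _ l] exI[of _ A])
  qed
  have "\<exists>\<Lambda>. \<forall>\<epsilon> S. 0 < \<epsilon> \<longrightarrow> finite S \<longrightarrow>
    (\<exists>l A. Q \<epsilon> l A \<and> \<Lambda> \<subseteq> exponent_kernel l k A \<and> exponent_kernel l k A \<inter> S \<subseteq> \<Lambda>)"
  proof (rule generic_kernel)
    show "\<exists>l A. Q \<epsilon> l A" if "0 < \<epsilon>" for \<epsilon>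
      using that by (rule Q_ex)
    show "Q \<epsilon>' l A" if "Q \<epsilon> l A" "\<epsilon> \<le> \<epsilon>'" for \<epsilon> \<epsilon>' l A
      using that by (rule Q_mono)
  qed
  then obtain \<Lambda> where \<Lambda>: "\<And>\<epsilon> S. 0 < \<epsilon> \<Longrightarrow> finite S \<Longrightarrow>
      \<exists>l A. Q \<epsilon> l A \<and> \<Lambda> \<subseteq> exponent_kernel l k A \<and> exponent_kernel l k A \<inter> S \<subseteq> \<Lambda>"
    by blast
  let ?K = "Poly_Mapping.keys F"
  \<comment> \<open>Testing the differences of exponents of F ensures that \<open>A\<close> merges
    two terms only because of a relation in \<open>\<Lambda>\<close>, which every later choice of
    \<open>A'\<close> shares.\<close>
  have "finite ((\<lambda>(e, e'). e - e') ` (?K \<times> ?K))"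
    by simp
  from \<Lambda>[OF zero_less_one this] obtain l A where A: "Q 1 l A" "\<Lambda> \<subseteq> exponent_kernel l k A"
      "exponent_kernel l k A \<inter> (\<lambda>(e, e'). e - e') ` (?K \<times> ?K) \<subseteq> \<Lambda>"
    by blast
  define r where "r = m l A"
  have r: "0 < r" and G0: "G l A \<noteq> 0"
    using A(1) by (auto simp: Q_def r_def)
  then have r4: "0 < r / 4"
    by simp
  obtain \<eta>0 where "0 < \<eta>0" and \<eta>0: "\<And>\<eta> l A u. 0 < \<eta> \<Longrightarrow> \<eta> \<le> \<eta>0 \<Longrightarrow> G l A \<noteq> 0 \<Longrightarrow>
      (\<forall>f\<in>Poly_Mapping.keys (G l A). norm (u f) = 1) \<Longrightarrow>
      (let f = trig_poly (Poly_Mapping.keys (G l A)) (\<lambda>f. Poly_Mapping.lookup (G l A) f * u f) in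
       (AE z in torus l. f z \<noteq> 0) \<and> integrable (torus l) (\<lambda>z. ln (norm (f z))) \<and>
       0 \<le> (\<integral>z. ln (max (norm (f z)) \<eta>) \<partial>torus l) \<and>
       (\<integral>z. ln (max (norm (f z)) \<eta>) \<partial>torus l) \<le> (\<integral>z. ln (norm (f z)) \<partial>torus l) + r / 4)"
    using trunc[OF r4] by blast
  define L where "L = (\<Sum>e\<in>?K. norm (c e))"
  have L: "0 \<le> L" by (simp add: L_def sum_nonneg)
  \<comment> \<open>On \<open>U\<close> the functions W(y, -) and F_A differ by at most
    \<open>L * \<rho>\<close>. The logarithm truncated at \<open>\<eta>0\<close> has Lipschitz
    constant \<open>1 / \<eta>0\<close>, so the error is at most \<open>r / 4\<close>. The summand 1
    keeps the denominator positive.\<close>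
  define \<rho> where "\<rho> = r * \<eta>0 / (4 * (L + 1))"
  have \<rho>: "0 < \<rho>" "L * \<rho> / \<eta>0 \<le> r / 4"
  proof -
    show "0 < \<rho>"
      using r \<open>0 < \<eta>0\<close> L by (simp add: \<rho>_def)
    have "L * \<rho> / \<eta>0 = L / (L + 1) * (r / 4)"
      using \<open>0 < \<eta>0\<close> by (simp add: \<rho>_def)
    also have "\<dots> \<le> 1 * (r / 4)"
      using r L by (intro mult_right_mono) auto
    finally show "L * \<rho> / \<eta>0 \<le> r / 4"
      by simp
  qed
  obtain \<delta> where "0 < \<delta>" and \<delta>: "\<And>l (K :: (nat \<Rightarrow>\<^sub>0 int) set) f. finite K \<Longrightarrow> card K \<le> N \<Longrightarrow> f ` K \<subseteq> exps_below l \<Longrightarrow>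
       \<delta> \<le> measure (torus l) {y \<in> space (torus l). \<forall>e\<in>K. norm (chi (f e) y - 1) < \<rho>}"
    using characters_simultaneously_near_1[OF \<rho>(1), of N] by blast
  \<comment> \<open>The final comparison bounds \<open>r * \<delta> / 2\<close> by less than
    \<open>4 * \<epsilon>\<close>, which is \<open>r * \<delta> / 8\<close> with this
    choice.\<close>
  define \<epsilon> where "\<epsilon> = \<delta> * r / 32"
  have \<epsilon>: "0 < \<epsilon>"
    using r \<open>0 < \<delta>\<close> by (simp add: \<epsilon>_def)
  obtain \<eta>1 where "0 < \<eta>1" and \<eta>1: "\<And>\<eta> l A. 0 < \<eta> \<Longrightarrow> \<eta> \<le> \<eta>1 \<Longrightarrow> G l A \<noteq> 0 \<Longrightarrow>
      (\<integral>z. ln (max (norm (laurent_eval (G l A) z)) \<eta>) \<partial>torus l) \<le> m l A + \<epsilon>"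
    using trunc1[OF \<epsilon>] by blast
  \<comment> \<open>The bound by \<open>\<eta>0\<close> gives nonnegative twisted means at height
    \<open>\<eta>\<close>, the bound by \<open>\<eta>1\<close> controls the truncation error for
    \<open>A'\<close>.\<close>
  define \<eta> where "\<eta> = min \<eta>0 \<eta>1"
  have \<eta>: "0 < \<eta>" "\<eta> \<le> \<eta>0" "\<eta> \<le> \<eta>1"
    using \<open>0 < \<eta>0\<close> \<open>0 < \<eta>1\<close> by (auto simp: \<eta>_def)
  obtain H where H: "H \<in> laurent_polys k" "\<And>z. (\<forall>j<k. norm (z j) = 1) \<Longrightarrow>
      norm (of_real (ln (max (norm (laurent_eval F z)) \<eta>)) - laurent_eval H z) \<le> \<epsilon>"
    using ln_max_norm_approx[OF F \<eta>(1) \<epsilon>] by blast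
  obtain l' A' where A': "Q \<epsilon> l' A'" "\<Lambda> \<subseteq> exponent_kernel l' k A'"
      "exponent_kernel l' k A' \<inter> Poly_Mapping.keys H \<subseteq> \<Lambda>"
    using \<Lambda>[OF \<epsilon>, of "Poly_Mapping.keys H"] by auto
  define W where "W = two_point_eval l' A' l A k F"
  have compat: "exponent_map l' k A' e = exponent_map l' k A' e'"
    if "e \<in> ?K" "e' \<in> ?K" "exponent_map l k A e = exponent_map l k A e'" for e e'
  proof -
    have "e - e' \<in> exponent_kernel l k A"
      using that by (simp add: exponent_kernel_def exponent_map_diff)
    then have "e - e' \<in> \<Lambda>"
      using A(3) that by auto
    then have "e - e' \<in> exponent_kernel l' k A'"
      using A'(2) by auto
    then show ?thesis
      by (simp add: exponent_kernel_def exponent_map_diff)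
  qed
  have W_le: "norm (W y x) \<le> L" if "y \<in> space (torus l')" "x \<in> space (torus l)" for y x
    unfolding W_def L_def c_def using that by (rule norm_two_point_eval_le)
  define \<phi> where "\<phi> y = (\<integral>x. ln (max (norm (W y x)) \<eta>) \<partial>torus l)" for y
  define U where "U = {y \<in> space (torus l'). \<forall>e\<in>?K. norm (chi (exponent_map l' k A' e) y - 1) < \<rho>}"
  have U: "U \<in> sets (torus l')"
    unfolding U_def
  proof (rule sets.sets_Collect_finite_All)
    fix e
    have [measurable]: "chi (exponent_map l' k A' e) \<in> borel_measurable (torus l')"
      by (rule chi_measurable[OF exponent_map_in_exps_below])
    show "{y \<in> space (torus l'). norm (chi (exponent_map l' k A' e) y - 1) < \<rho>} \<in> sets (torus l')"
      by measurable
  qed simp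
  have W_meas: "W y \<in> borel_measurable (torus l)" if "y \<in> space (torus l')" for y
    using measurable_Pair2[OF two_point_eval_measurable that] by (simp add: W_def)
  have int_W: "integrable (torus l) (\<lambda>x. ln (max (norm (W y x)) e))"
    if "y \<in> space (torus l')" "0 < e" for y e
    by (rule integrable_ln_max_norm[OF that(2) W_meas[OF that(1)] torus.prob_space_axioms W_le[OF that(1)]])
  \<comment> \<open>Half of \<open>r\<close> is lost on \<open>U\<close>: \<open>r / 4\<close> in
    replacing F_A by W(y, -) at height \<open>\<eta>0\<close>, and \<open>r / 4\<close> in removing
    that truncation.\<close>
  have \<phi>_ge: "(r / 2) * indicator U y \<le> \<phi> y" if y: "y \<in> space (torus l')" for y
  proof -
    obtain u where u: "\<forall>f\<in>Poly_Mapping.keys (G l A). norm (u f) = 1"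
      "\<And>x. W y x = trig_poly (Poly_Mapping.keys (G l A)) (\<lambda>f. Poly_Mapping.lookup (G l A) f * u f) x"
      using two_point_eval_twist[of F l k A l' A', OF compat y] unfolding W_def G_def by metis
    note t = \<eta>0[OF _ _ G0 u(1), unfolded Let_def u(2)[symmetric]]
    have nonneg: "0 \<le> \<phi> y"
      using t[OF \<eta>(1,2)] by (simp add: \<phi>_def)
    show ?thesis
    proof (cases "y \<in> U")
      case False
      then show ?thesis using nonneg by simp
    next
      case True
      have close: "norm (W y x - laurent_eval (G l A) x) \<le> L * \<rho>" if x: "x \<in> space (torus l)" for x
      proof -
        have "W y x - laurent_eval (G l A) x = (\<Sum>e\<in>?K. c e *
            (chi (exponent_map l' k A' e) y - 1) * chi (exponent_map l k A e) x)"
          by (simp add: W_def G_def c_def two_point_eval_def laurent_eval_monomial_subst_sum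
              sum_subtractf[symmetric] algebra_simps)
        also have "norm \<dots> \<le> (\<Sum>e\<in>?K. norm (c e) * \<rho>)"
        proof (intro order_trans[OF norm_sum] sum_mono)
          fix e assume "e \<in> ?K"
          then have "norm (chi (exponent_map l' k A' e) y - 1) \<le> \<rho>"
            using True by (auto simp: U_def)
          then show "norm (c e * (chi (exponent_map l' k A' e) y - 1) * chi (exponent_map l k A e) x) \<le> norm (c e) * \<rho>"
            using norm_chi_torus[OF exponent_map_in_exps_below x] by (simp add: norm_mult mult_left_mono)
        qed
        finally show ?thesis
          by (simp add: L_def sum_distrib_right)
      qed
      have int_G: "integrable (torus l) (\<lambda>x. ln (max (norm (laurent_eval (G l A) x)) \<eta>0))"
        unfolding laurent_eval_eq_trig_poly
        by (rule integrable_ln_max_norm[OF \<open>0 < \<eta>0\<close> trig_poly_measurable[OF G_keys(1)]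
              torus.prob_space_axioms norm_trig_poly_le[OF G_keys(1)]])
      have "r \<le> (\<integral>x. ln (max (norm (laurent_eval (G l A) x)) \<eta>0) \<partial>torus l)"
        unfolding r_def m_eq
      proof (rule integral_mono_AE[OF _ int_G])
        note t1 = \<eta>0[OF \<open>0 < \<eta>0\<close> order_refl G0, of "\<lambda>_. 1"]
        then show "integrable (torus l) (\<lambda>x. ln (norm (laurent_eval (G l A) x)))"
          by (simp add: Let_def laurent_eval_eq_trig_poly)
        have "AE x in torus l. laurent_eval (G l A) x \<noteq> 0"
          using t1 by (simp add: Let_def laurent_eval_eq_trig_poly)
        then show "AE x in torus l. ln (norm (laurent_eval (G l A) x)) \<le>
            ln (max (norm (laurent_eval (G l A) x)) \<eta>0)"
          by eventually_elim (subst ln_le_cancel_iff, auto simp: less_max_iff_disj)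
      qed
      also have "\<dots> \<le> (\<integral>x. ln (max (norm (W y x)) \<eta>0) + r / 4 \<partial>torus l)"
      proof (rule integral_mono[OF int_G])
        show "integrable (torus l) (\<lambda>x. ln (max (norm (W y x)) \<eta>0) + r / 4)"
          using int_W[OF y \<open>0 < \<eta>0\<close>] by simp
        fix x assume x: "x \<in> space (torus l)"
        have "\<bar>norm (laurent_eval (G l A) x) - norm (W y x)\<bar> \<le> L * \<rho>"
          using close[OF x] norm_triangle_ineq3[of "W y x" "laurent_eval (G l A) x"] by linarith
        then have "\<bar>norm (laurent_eval (G l A) x) - norm (W y x)\<bar> / \<eta>0 \<le> L * \<rho> / \<eta>0"
          using \<open>0 < \<eta>0\<close> by (intro divide_right_mono) auto
        then show "ln (max (norm (laurent_eval (G l A) x)) \<eta>0) \<le> ln (max (norm (W y x)) \<eta>0) + r / 4"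
          using ln_max_lipschitz[OF \<open>0 < \<eta>0\<close>, of "norm (laurent_eval (G l A) x)" "norm (W y x)"] \<rho>(2)
          by linarith
      qed
      also have "\<dots> = (\<integral>x. ln (max (norm (W y x)) \<eta>0) \<partial>torus l) + r / 4"
        using int_W[OF y \<open>0 < \<eta>0\<close>] by (simp add: torus.prob_space)
      also have "(\<integral>x. ln (max (norm (W y x)) \<eta>0) \<partial>torus l) \<le> (\<integral>x. ln (norm (W y x)) \<partial>torus l) + r / 4"
        using t[OF \<open>0 < \<eta>0\<close> order_refl] by simp
      \<comment> \<open>The untruncated logarithm mediates between the heights: lowering
        \<open>\<eta>0\<close> to \<open>\<eta>\<close> directly would go in the wrong
        direction.\<close>
      also have "(\<integral>x. ln (norm (W y x)) \<partial>torus l) \<le> \<phi> y"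
        unfolding \<phi>_def
      proof (rule integral_mono_AE[OF _ int_W[OF y \<eta>(1)]])
        show "integrable (torus l) (\<lambda>x. ln (norm (W y x)))"
          using t[OF \<eta>(1,2)] by simp
        have "AE x in torus l. W y x \<noteq> 0"
          using t[OF \<eta>(1,2)] by simp
        then show "AE x in torus l. ln (norm (W y x)) \<le> ln (max (norm (W y x)) \<eta>)"
          by eventually_elim (subst ln_le_cancel_iff, auto simp: less_max_iff_disj)
      qed
      finally show ?thesis using True by simp
    qed
  qed
  have int_pair: "integrable (torus l' \<Otimes>\<^sub>M torus l) (\<lambda>(y, x). ln (max (norm (W y x)) \<eta>))"
  proof -
    have "integrable (torus l' \<Otimes>\<^sub>M torus l) (\<lambda>p. ln (max (norm (case_prod W p)) \<eta>))"
    proof (rule integrable_ln_max_norm[OF \<eta>(1) _ torus_pair.P.prob_space_axioms])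
      show "case_prod W \<in> borel_measurable (torus l' \<Otimes>\<^sub>M torus l)"
        unfolding W_def by (rule two_point_eval_measurable)
      show "norm (case_prod W p) \<le> L" if "p \<in> space (torus l' \<Otimes>\<^sub>M torus l)" for p
        using that by (auto simp: space_pair_measure W_le)
    qed
    then show ?thesis
      by (simp add: case_prod_unfold)
  qed
  have int_U: "integrable (torus l') (\<lambda>y. (r / 2) * indicator U y)"
    using U by (intro integrable_mult_right integrable_real_indicator) (simp_all add: torus.emeasure_eq_measure)
  have "\<delta> \<le> measure (torus l') U"
    unfolding U_def by (intro \<delta> image_subsetI exponent_map_in_exps_below) (simp_all add: N_def)
  then have "(r / 2) * \<delta> \<le> (r / 2) * measure (torus l') U"
    using r by (intro mult_left_mono) auto
  also have "\<dots> = (\<integral>y. (r / 2) * indicator U y \<partial>torus l')"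
    using U by simp
  also have "\<dots> \<le> (\<integral>y. \<phi> y \<partial>torus l')"
    unfolding \<phi>_def
    by (rule integral_mono[OF int_U torus_pair.integrable_fst[OF int_pair]])
       (rule \<phi>_ge[unfolded \<phi>_def])
  also have "\<dots> = (\<integral>x. (\<integral>y. ln (max (norm (W y x)) \<eta>) \<partial>torus l') \<partial>torus l)"
    unfolding \<phi>_def by (rule torus_pair.Fubini_integral[OF int_pair, symmetric])
  \<comment> \<open>Moving \<open>x\<close> to the identity of the torus costs
    \<open>2 * \<epsilon>\<close>, and removing the truncation from F_A' costs one more
    \<open>\<epsilon>\<close>.\<close>
  also have "\<dots> \<le> (\<integral>x. m l' A' + 3 * \<epsilon> \<partial>torus l)"
  proof (rule integral_mono[OF torus_pair.integrable_snd[OF int_pair]])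
    fix x assume x: "x \<in> space (torus l)"
    \<comment> \<open>The identity of the torus, at which all characters in \<open>x\<close> are 1
      and W reduces to F_A'.\<close>
    define x0 where "x0 = (\<lambda>i\<in>{..<l}. 1 :: complex)"
    have x0: "x0 \<in> space (torus l)"
      by (auto simp: x0_def space_torus)
    have W0: "W y x0 = laurent_eval (G l' A') y" for y
      unfolding W_def two_point_eval_def G_def laurent_eval_monomial_subst_sum
      by (intro sum.cong refl) (simp add: chi_ones[OF _ exponent_map_in_exps_below] x0_def)
    have "(\<integral>y. ln (max (norm (W y x)) \<eta>) \<partial>torus l') \<le> (\<integral>y. ln (max (norm (W y x0)) \<eta>) \<partial>torus l') + 2 * \<epsilon>"
      unfolding W_def
      by (rule integral_two_point_eval_indep[OF F \<eta>(1) H _ x x0]) (use A(2) A'(3) in auto)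
    also have "(\<integral>y. ln (max (norm (W y x0)) \<eta>) \<partial>torus l') \<le> m l' A' + \<epsilon>"
      unfolding W0 using A'(1) by (intro \<eta>1 \<eta>) (simp add: Q_def)
    finally show "(\<integral>y. ln (max (norm (W y x)) \<eta>) \<partial>torus l') \<le> m l' A' + 3 * \<epsilon>"
      by simp
  qed simp
  also have "\<dots> = m l' A' + 3 * \<epsilon>"
    by (simp add: torus.prob_space)
  also have "\<dots> < 4 * \<epsilon>"
    using A'(1) by (simp add: Q_def)
  also have "\<dots> = (r / 2) * \<delta> / 4"
    by (simp add: \<epsilon>_def)
  finally show False
    using r \<open>0 < \<delta>\<close> by (simp add: field_simps)
qed

end
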